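(* Let $M\Subset\mathbb{C}^n$ ($n\geqslant 2$) be a connected $\mathcal{C}^\infty$ hypersurface bounding a domain $\Omega_M\Subset\mathbb{C}^n$. Suppose to fix ideas that $2\leqslant \mathrm{dist}(0,\overline{\Omega}_M)\leqslant 5$ and assume that the restriction $r_M:=r|_M$ of the distance function $r(z)=\|z\|$ to $M$ is a Morse function having only a finite number $\kappa$ of critical points $\widehat{p}_\lambda\in M$, $1\leqslant\lambda\leqslant\kappa$, located on different sphere levels: $$2\leqslant \widehat{r}_1:=r(\widehat{p}_1)<\cdots<\widehat{r}_\kappa:=r(\widehat{p}_\kappa)\leqslant 5+\mathrm{diam}(\overline{\Omega}_M).$$ Then there exists $\delta_1>0$ such that for every $\delta$ with $0<\delta\leqslant\delta_1$, the (tubular) neighborhood $\mathcal{V}_\delta(M)$ enjoys the global Hartogs extension property into $\Omega_M$: $$\mathcal{O}\big(\mathcal{V}_\delta(M)\big)=\mathcal{O}\big(\Omega_M\cup\mathcal{V}_\delta(M)\big)\big|_{\mathcal{V}_\delta(M)},$$ by "pushing" analytic discs inside a finite number of Levi-Hartogs figures, using neither the Martinelli kernel nor solutions of an auxiliary $\overline{\partial}$ problem.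
   Context: $\|z\|=(|z_1|^2+\cdots+|z_n|^2)^{1/2}$ is the Euclidean norm on $\mathbb{C}^n$, $\mathbb{B}^n(p,\delta)=\{\|z-p\|<\delta\}$, and for a set $E\subset\mathbb{C}^n$, $\mathcal{V}_\delta(E):=\bigcup_{p\in E}\mathbb{B}^n(p,\delta)$. The symbol $\Subset$ means relatively compact in; "$M$ bounds $\Omega_M$" means $\partial\Omega_M=M$. $\mathcal{O}(\mathcal{U})$ is the ring of holomorphic functions in the open set $\mathcal{U}$. The equality $\mathcal{O}(\mathcal{U}_1)=\mathcal{O}(\mathcal{U}_1\cup\mathcal{U}_2)|_{\mathcal{U}_1}$ means: for every $f\in\mathcal{O}(\mathcal{U}_1)$ there exists $F\in\mathcal{O}(\mathcal{U}_1\cup\mathcal{U}_2)$ with $F|_{\mathcal{U}_1}=f$. A Morse function is one whose critical points are all nondegenerate (Hessian matrix with nonzero determinant). Levi-Hartogs figures: with $z_n=x_n+iy_n$ and small $\varepsilon_1,\varepsilon_2>0$, $$\mathcal{LH}_{\varepsilon_1,\varepsilon_2}:=\Big\{\max_{1\leqslant i\leqslant n-1}|z_i|<\varepsilon_1,\ |x_n|<\varepsilon_1,\ -\varepsilon_2<y_n<0\Big\}\cup\Big\{\varepsilon_1-(\varepsilon_1)^2<\max_{1\leqslant i\leqslant n-1}|z_i|<\varepsilon_1,\ |x_n|<\varepsilon_1,\ |y_n|<\varepsilon_2\Big\}.$$ Holomorphic functions in this set extend holomorphically to the full parallelepiped $$\Big\{\max_{1\leqslant i\leqslant n-1}|z_i|<\varepsilon_1,\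 |x_n|<\varepsilon_1,\ |y_n|<\varepsilon_2\Big\}$$ by computing Cauchy integrals on analytic discs contained in complex lines parallel to $\mathbb{C}^{n-1}\times\{0\}$ whose boundaries remain in $\mathcal{LH}_{\varepsilon_1,\varepsilon_2}$; the discs are "pushed" (translated) so as to fill in the parallelepiped. These figures are repositioned in $\mathbb{C}^n$ by affine maps $z\mapsto p+Uz$ with $U\in\mathsf{SU}(n,\mathbb{C})$. The last clause of the claim describes the method by which the extension is obtained: finitely many such local extension steps are used, rather than the (multidimensional) Martinelli integral kernel or the solution of a $\overline{\partial}$-equation. *)

theory Defs
  imports "HOL-Analysis.Analysis"
begin

subsection \<open>Holomorphic functions of several complex variables\<close>

text \<open>The library's \<open>holomorphic_on\<close> is restricted to one variable. As there, functions are
  total and only their values on the open set matter.\<close>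

definition hol_functions :: "(complex ^ 'n::finite) set \<Rightarrow> (complex ^ 'n \<Rightarrow> complex) set" where
  "hol_functions U =
     {f. \<forall>z\<in>U. \<exists>L. (f has_derivative L) (at z) \<and> (\<forall>c v. L (c *s v) = c * L v)}"

definition hol_extends :: "(complex ^ 'n::finite) set \<Rightarrow> (complex ^ 'n) set \<Rightarrow> bool" where
  "hol_extends U1 U2 \<longleftrightarrow>
     (\<forall>f\<in>hol_functions U1. \<exists>F\<in>hol_functions (U1 \<union> U2). \<forall>z\<in>U1. F z = f z)"

definition tube :: "real \<Rightarrow> 'a::metric_space set \<Rightarrow> 'a set" where
  "tube \<delta> E = (\<Union>p\<in>E. ball p \<delta>)"


subsection \<open>Smooth hypersurfaces and Morse functions\<close>

primrec Ck_on ::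
  "nat \<Rightarrow> ('a::real_normed_vector \<Rightarrow> 'b::real_normed_vector) \<Rightarrow> 'a set \<Rightarrow> bool" where
  "Ck_on 0 f S \<longleftrightarrow> continuous_on S f"
| "Ck_on (Suc k) f S \<longleftrightarrow>
     (\<exists>f'. (\<forall>x\<in>S. (f has_derivative f' x) (at x)) \<and> (\<forall>v. Ck_on k (\<lambda>x. f' x v) S))"

text \<open>Only used for open \<open>S\<close> in a finite-dimensional space, where directional derivatives
  suffice to describe \<open>C\<^sup>k\<close>.\<close>

definition smooth_on :: "('a::real_normed_vector \<Rightarrow> 'b::real_normed_vector) \<Rightarrow> 'a set \<Rightarrow> bool" where
  "smooth_on f S \<longleftrightarrow> (\<forall>k. Ck_on k f S)"

text \<open>A real hypersurface of \<open>\<complex>\<^sup>n\<close> has real dimension \<open>2n - 1\<close>. The index type below has exactly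
  that many elements, so that \<open>real ^ 'n hyp_index\<close> is the space of local coordinates.\<close>

typedef ('n::finite) hyp_index = "UNIV - {undefined} :: ('n + 'n) set"
proof -
  have "(Inl undefined :: 'n + 'n) \<noteq> Inr undefined" by simp
  then show "\<exists>x. x \<in> (UNIV - {undefined} :: ('n + 'n) set)" by (metis DiffI UNIV_I singletonD)
qed

instance hyp_index :: (finite) finite
proof
  have "finite (range (Rep_hyp_index :: 'a hyp_index \<Rightarrow> 'a + 'a))" by simp
  then show "finite (UNIV :: 'a hyp_index set)"
    by (rule finite_imageD) (simp add: inj_on_def Rep_hyp_index_inject)
qed

lemma CARD_hyp_index: "CARD('n::finite hyp_index) = 2 * CARD('n) - 1"
proof -
  have "CARD('n hyp_index) = card (UNIV - {undefined} :: ('n + 'n) set)"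
    by (rule type_definition.card [OF type_definition_hyp_index])
  then show ?thesis by (simp add: card_Diff_singleton)
qed

text \<open>\<open>\<psi>\<close> is a smooth embedding of the open set \<open>D\<close> onto a relatively open part of \<open>M\<close>.\<close>

definition local_param ::
  "(complex ^ 'n::finite) set \<Rightarrow> (real ^ 'n hyp_index) set \<Rightarrow>
   (real ^ 'n hyp_index \<Rightarrow> complex ^ 'n) \<Rightarrow> bool" where
  "local_param M D \<psi> \<longleftrightarrow>
     open D \<and> smooth_on \<psi> D \<and>
     (\<forall>u\<in>D. inj (frechet_derivative \<psi> (at u))) \<and>
     openin (top_of_set M) (\<psi> ` D) \<and>
     (\<exists>\<psi>inv. homeomorphism D (\<psi> ` D) \<psi> \<psi>inv)"

definition smooth_hypersurface :: "(complex ^ 'n::finite) set \<Rightarrow> bool" where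
  "smooth_hypersurface M \<longleftrightarrow> (\<forall>p\<in>M. \<exists>D \<psi>. local_param M D \<psi> \<and> p \<in> \<psi> ` D)"

definition partial_deriv :: "'m::finite \<Rightarrow> (real ^ 'm \<Rightarrow> real) \<Rightarrow> real ^ 'm \<Rightarrow> real" where
  "partial_deriv i g u = frechet_derivative g (at u) (axis i 1)"

definition hessian :: "(real ^ 'm::finite \<Rightarrow> real) \<Rightarrow> real ^ 'm \<Rightarrow> real ^ 'm ^ 'm" where
  "hessian g u = (\<chi> i j. partial_deriv i (partial_deriv j g) u)"

text \<open>The function \<open>f\<close> on the ambient space stands for its restriction to \<open>M\<close>. For smooth
  \<open>f\<close> on \<open>M\<close>, vanishing of the differential, and at a critical point non-vanishing of the Hessian
  determinant, do not depend on the local parametrization.\<close>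

definition critical_points ::
  "(complex ^ 'n::finite) set \<Rightarrow> (complex ^ 'n \<Rightarrow> real) \<Rightarrow> (complex ^ 'n) set" where
  "critical_points M f =
     {p. \<exists>D \<psi> u. local_param M D \<psi> \<and> u \<in> D \<and> \<psi> u = p \<and>
           (f \<circ> \<psi> has_derivative (\<lambda>v. 0)) (at u)}"

definition morse_on :: "(complex ^ 'n::finite) set \<Rightarrow> (complex ^ 'n \<Rightarrow> real) \<Rightarrow> bool" where
  "morse_on M f \<longleftrightarrow>
     (\<forall>D \<psi>. local_param M D \<psi> \<longrightarrow> smooth_on (f \<circ> \<psi>) D) \<and>
     (\<forall>p\<in>critical_points M f. \<exists>D \<psi> u. local_param M D \<psi> \<and> u \<in> D \<and> \<psi> u = p \<and>
           det (hessian (f \<circ> \<psi>) u) \<noteq> 0)"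


subsection \<open>Levi--Hartogs figures\<close>

text \<open>The index \<open>k\<close> plays the role of the last coordinate; \<open>other_max k z\<close> is the maximum of
  \<open>\<bar>z\<^sub>i\<bar>\<close> over the remaining ones, of which there are some as soon as \<open>n \<ge> 2\<close>.\<close>

definition other_max :: "'n::finite \<Rightarrow> complex ^ 'n \<Rightarrow> real" where
  "other_max k z = Max ((\<lambda>i. cmod (z $ i)) ` (UNIV - {k}))"

definition levi_hartogs :: "'n::finite \<Rightarrow> real \<Rightarrow> real \<Rightarrow> (complex ^ 'n) set" where
  "levi_hartogs k \<epsilon>1 \<epsilon>2 =
     {z. other_max k z < \<epsilon>1 \<and> \<bar>Re (z $ k)\<bar> < \<epsilon>1 \<and> - \<epsilon>2 < Im (z $ k) \<and> Im (z $ k) < 0} \<union>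
     {z. \<epsilon>1 - \<epsilon>1\<^sup>2 < other_max k z \<and> other_max k z < \<epsilon>1 \<and>
         \<bar>Re (z $ k)\<bar> < \<epsilon>1 \<and> \<bar>Im (z $ k)\<bar> < \<epsilon>2}"

definition levi_hartogs_box :: "'n::finite \<Rightarrow> real \<Rightarrow> real \<Rightarrow> (complex ^ 'n) set" where
  "levi_hartogs_box k \<epsilon>1 \<epsilon>2 =
     {z. other_max k z < \<epsilon>1 \<and> \<bar>Re (z $ k)\<bar> < \<epsilon>1 \<and> \<bar>Im (z $ k)\<bar> < \<epsilon>2}"

definition SU :: "(complex ^ 'n::finite ^ 'n) set" where
  "SU = {U. (\<chi> i j. cnj (U $ j $ i)) ** U = mat 1 \<and> det U = 1}"

text \<open>Pairs consisting of a repositioned figure and its full parallelepiped. The bound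
  \<open>\<epsilon>1 < 1\<close> is what smallness has to guarantee: the inner radius \<open>\<epsilon>1 - \<epsilon>1\<^sup>2\<close> is positive.\<close>

definition levi_hartogs_figures :: "'n::finite \<Rightarrow> ((complex ^ 'n) set \<times> (complex ^ 'n) set) set" where
  "levi_hartogs_figures k =
     {((\<lambda>z. p + U *v z) ` levi_hartogs k \<epsilon>1 \<epsilon>2, (\<lambda>z. p + U *v z) ` levi_hartogs_box k \<epsilon>1 \<epsilon>2)
      | p U \<epsilon>1 \<epsilon>2. U \<in> SU \<and> 0 < \<epsilon>1 \<and> \<epsilon>1 < 1 \<and> 0 < \<epsilon>2}"

text \<open>\<open>obtained_by_pushing \<H> V f W g\<close>: starting from the function \<open>f\<close> on \<open>V\<close>, the function \<open>g\<close>
  on \<open>W\<close> is reached in finitely many steps, the only step creating new values being the local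
  extension inside one of the figures of \<open>\<H>\<close>. As the figure \<open>H\<close> is a nonempty open part of the
  connected box \<open>B\<close>, the function \<open>h\<close> in that step is the one given by the Cauchy integrals on the
  pushed discs. The remaining steps restrict to smaller open sets and glue functions that agree
  on the overlap, which is all that is needed to control monodromy.\<close>

inductive obtained_by_pushing ::
  "((complex ^ 'n::finite) set \<times> (complex ^ 'n) set) set \<Rightarrow>
   (complex ^ 'n) set \<Rightarrow> (complex ^ 'n \<Rightarrow> complex) \<Rightarrow>
   (complex ^ 'n) set \<Rightarrow> (complex ^ 'n \<Rightarrow> complex) \<Rightarrow> bool"
  for \<H> V f where
  start: "obtained_by_pushing \<H> V f V f"
| restrict: "obtained_by_pushing \<H> V f W' h"
    if "obtained_by_pushing \<H> V f W g" "open W'" "W' \<subseteq> W" "\<forall>z\<in>W'. h z = g z"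
| push: "obtained_by_pushing \<H> V f B h"
    if "obtained_by_pushing \<H> V f W g" "(H, B) \<in> \<H>" "H \<subseteq> W"
       "h \<in> hol_functions B" "\<forall>z\<in>H. h z = g z"
| glue: "obtained_by_pushing \<H> V f (W1 \<union> W2) h"
    if "obtained_by_pushing \<H> V f W1 g1" "obtained_by_pushing \<H> V f W2 g2"
       "\<forall>z\<in>W1. h z = g1 z" "\<forall>z\<in>W2. h z = g2 z"

definition extends_by_pushing :: "'n::finite \<Rightarrow> (complex ^ 'n) set \<Rightarrow> (complex ^ 'n) set \<Rightarrow> bool" where
  "extends_by_pushing k U1 U2 \<longleftrightarrow>
     (\<exists>\<H>. finite \<H> \<and> \<H> \<subseteq> levi_hartogs_figures k \<and>
        (\<forall>f\<in>hol_functions U1. \<exists>F\<in>hol_functions (U1 \<union> U2).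
           (\<forall>z\<in>U1. F z = f z) \<and> obtained_by_pushing \<H> U1 f (U1 \<union> U2) F))"

end

theory Submission
  imports Defs "HOL-Complex_Analysis.Conformal_Mappings"
begin

text \<open>
  Write \<open>V\<close> for the tube around \<open>M\<close> and \<open>G = V \<union> \<Omega>\<close>. Since the frontier \<open>M\<close> of \<open>\<Omega>\<close> lies in \<open>V\<close>, the
  set \<open>K = G - V\<close> is compact, and \<open>V = G - K\<close> is connected because \<open>M\<close> is. The proof splits into an
  analytic and a geometric half, and works for every positive radius of the tube.

  The analytic half (\<open>hartogs_extension\<close>) produces the extension \<open>F\<close> on all of \<open>G\<close> at once, by the
  argument of Ehrenpreis. Multiply \<open>f\<close> by a function \<open>\<omega>\<close> that vanishes near \<open>K\<close> and is \<open>1\<close> outside a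
  compact subset of \<open>G\<close>. The product \<open>\<omega> f\<close> makes sense on \<open>G\<close>, and its Cauchy-Riemann defects
  \<open>f \<cdot> dbar\<^sub>j \<omega>\<close> have compact support. Integrating the defect in one coordinate
  against the Cauchy kernel over the complex lines parallel to that axis corrects the defects in all
  coordinates simultaneously (\<open>dbar_cauchy_transform\<close>, \<open>cauchy_transform_dbar\<close>). As there is a
  second coordinate, many of these lines miss the support altogether; there the correction vanishes
  and \<open>F = f\<close>, and the identity theorem on the connected set \<open>V\<close> carries this equality to the whole
  tube.

  The geometric half (\<open>filling_by_pushing\<close>) shows that \<open>F\<close> is reached from \<open>f\<close> by pushing discs. The
  set \<open>G\<close> is swept by concentric spheres of decreasing radius. The exterior of a sphere is strictly
  pseudoconcave, so that a Levi-Hartogs figure whose last axis is turned into the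
  direction of the centre can be placed with its figure strictly outside the sphere while its box
  crosses it (\<open>levi_hartogs_figure_across_sphere\<close>). By compactness of \<open>K\<close> finitely many boxes of one
  fixed size, all inside \<open>G\<close>, lower the radius by a fixed amount, and finitely many such rounds
  exhaust \<open>G\<close>, whose part outside \<open>V\<close> stays away from the origin. Every local extension agrees with
  the same \<open>F\<close>, so the pieces glue without any monodromy.
\<close>

section \<open>Holomorphic functions on complex lines\<close>

lemma hol_functions_mono:
  "f \<in> hol_functions U \<Longrightarrow> V \<subseteq> U \<Longrightarrow> f \<in> hol_functions V"
  by (auto simp: hol_functions_def)

lemma hol_functions_frechet:
  assumes "f \<in> hol_functions U" "z \<in> U"
  shows "(f has_derivative frechet_derivative f (at z)) (at z)"
    and "frechet_derivative f (at z) (c *s v) = c * frechet_derivative f (at z) v"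
proof -
  obtain L where L: "(f has_derivative L) (at z)" "\<forall>c v. L (c *s v) = c * L v"
    using assms by (auto simp: hol_functions_def)
  have "frechet_derivative f (at z) = L"
    using L(1) frechet_derivative_at by metis
  with L show "(f has_derivative frechet_derivative f (at z)) (at z)"
    and "frechet_derivative f (at z) (c *s v) = c * frechet_derivative f (at z) v"
    by auto
qed

lemma hol_functions_continuous_on:
  assumes "f \<in> hol_functions U"
  shows "continuous_on U f"
  by (meson assms continuous_at_imp_continuous_on has_derivative_continuous hol_functions_frechet(1))

lemma hol_functions_diff:
  assumes "f \<in> hol_functions U" "g \<in> hol_functions U"
  shows "(\<lambda>z. f z - g z) \<in> hol_functions U"
  unfolding hol_functions_def
proof (intro CollectI ballI)
  fix z assume z: "z \<in> U"
  obtain L where "(f has_derivative L) (at z)" "\<forall>c v. L (c *s v) = c * L v"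
    using assms z unfolding hol_functions_def by blast
  moreover obtain M where "(g has_derivative M) (at z)" "\<forall>c v. M (c *s v) = c * M v"
    using assms z unfolding hol_functions_def by blast
  ultimately show "\<exists>N. ((\<lambda>z. f z - g z) has_derivative N) (at z) \<and> (\<forall>c v. N (c *s v) = c * N v)"
    by (intro exI[of _ "\<lambda>v. L v - M v"]) (auto intro: has_derivative_diff simp: algebra_simps)
qed

lemma bounded_linear_scalar_mult_left: "bounded_linear (\<lambda>t::complex. t *s (v::complex^'n::finite))"
proof -
  have "linear (\<lambda>t::complex. t *s (v::complex^'n::finite))"
    by (rule linearI) (simp_all add: vec_eq_iff algebra_simps)
  then show ?thesis by (simp add: linear_conv_bounded_linear)
qed

text \<open>Restriction to complex lines is the bridge to the one-variable theory: it
  provides the identity theorem and, through Cauchy's estimate, continuity of the derivative.\<close>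

lemma hol_functions_line:
  fixes w v :: "complex ^ 'n::finite"
  assumes "f \<in> hol_functions U" "w + t *s v \<in> U"
  shows "((\<lambda>t. f (w + t *s v)) has_field_derivative frechet_derivative f (at (w + t *s v)) v) (at t)"
proof -
  have "((\<lambda>t. w + t *s v) has_derivative (\<lambda>t. t *s v)) (at t)"
    using bounded_linear_imp_has_derivative[OF bounded_linear_scalar_mult_left, of v "at t"]
    by (auto intro!: derivative_eq_intros)
  from has_derivative_compose[OF this hol_functions_frechet(1)[OF assms]]
  moreover have "(\<lambda>s. frechet_derivative f (at (w + t *s v)) (s *s v))
      = (*) (frechet_derivative f (at (w + t *s v)) v)"
    by (simp add: hol_functions_frechet(2)[OF assms] mult.commute fun_eq_iff)
  ultimately show ?thesis by (simp add: has_field_derivative_def)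
qed

lemma continuous_on_line [continuous_intros]:
  "continuous_on S (\<lambda>t. w + t *s (v::complex^'n::finite))"
  by (intro continuous_intros linear_continuous_on bounded_linear_scalar_mult_left)

lemma open_line_preimage:
  fixes v w :: "complex ^ 'n::finite"
  assumes "open U"
  shows "open {t. w + t *s v \<in> U}"
  using open_vimage[OF assms continuous_on_line[of UNIV w v]] by (simp add: vimage_def)

text \<open>The interior of the zero set is relatively closed: if a ball around a limit point meets it, join the
  meeting point to any point of the ball by a complex line and apply the one-variable identity theorem
  on the convex part of that line inside the ball.\<close>

lemma hol_functions_identity:
  fixes g :: "complex ^ 'n::finite \<Rightarrow> complex"
  assumes V: "open V" "connected V" and g: "g \<in> hol_functions V"
    and A: "open A" "A \<noteq> {}" "A \<subseteq> V" "\<And>z. z \<in> A \<Longrightarrow> g z = 0"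
    and z: "z \<in> V"
  shows "g z = 0"
proof -
  define Z where "Z = interior {z \<in> V. g z = 0}"
  have key: "ball x e \<subseteq> Z" if xe: "ball x e \<subseteq> V" "w \<in> ball x e" "w \<in> Z" for x e w
  proof -
    have "g v = 0" if v: "v \<in> ball x e" for v
    proof -
      define I where "I = {t. w + t *s (v - w) \<in> ball x e}"
      define J where "J = {t. w + t *s (v - w) \<in> Z}"
      have oI: "open I" unfolding I_def by (rule open_line_preimage) simp
      have oJ: "open J" unfolding J_def by (rule open_line_preimage) (simp add: Z_def)
      have "convex I"
      proof (rule convexI)
        fix s t a b assume st: "s \<in> I" "t \<in> I" and ab: "(0::real) \<le> a" "0 \<le> b" "a + b = 1"
        have "w + (a *\<^sub>R s + b *\<^sub>R t) *s (v - w)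
            = (a+b) *\<^sub>R w + (a *\<^sub>R s + b *\<^sub>R t) *s (v - w)" using ab by simp
        also have "\<dots> = a *\<^sub>R (w + s *s (v - w)) + b *\<^sub>R (w + t *s (v - w))"
          unfolding vec_eq_iff by (simp add: scaleR_conv_of_real[where 'a=complex] algebra_simps)
        finally show "a *\<^sub>R s + b *\<^sub>R t \<in> I"
          using convexD[OF convex_ball[of x e], of "w + s *s (v - w)" "w + t *s (v - w)" a b] st ab
          by (simp add: I_def)
      qed
      then have cI: "connected I" by (rule convex_connected)
      have hol: "(\<lambda>t. g (w + t *s (v - w))) holomorphic_on I"
        unfolding holomorphic_on_open[OF oI]
        using hol_functions_line[OF g] xe(1) unfolding I_def by blast
      have JI: "0 \<in> J \<inter> I" using xe by (simp add: J_def I_def)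
      have lim: "0 islimpt (J \<inter> I)"
        using interior_limit_point[of 0 "J \<inter> I"] JI oI oJ by (simp add: interior_open open_Int)
      have one: "1 \<in> I" using v by (simp add: I_def)
      have "g (w + 1 *s (v - w)) = 0"
        using analytic_continuation[OF hol oI cI _ _ lim _ one] JI interior_subset
        by (force simp: J_def Z_def)
      then show ?thesis by simp
    qed
    then show ?thesis unfolding Z_def using xe(1) by (intro interior_maximal) auto
  qed
  have "Z = {} \<or> Z = V"
  proof (rule connected_clopen[THEN iffD1, rule_format, OF V(2)])
    have ZV: "Z \<subseteq> V" unfolding Z_def using interior_subset by blast
    show "openin (top_of_set V) Z \<and> closedin (top_of_set V) Z"
    proof
      show "openin (top_of_set V) Z" using ZV by (auto simp: Z_def intro: open_subset)
      have "x \<in> Z" if x: "x \<in> closure Z" "x \<in> V" for x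
      proof -
        obtain e where e: "e > 0" "ball x e \<subseteq> V" using V(1) x(2) openE by blast
        then obtain w where "w \<in> Z" "w \<in> ball x e"
          using x(1) unfolding closure_approachable by (metis dist_commute mem_ball)
        with key e show ?thesis by (meson centre_in_ball subsetD)
      qed
      then have "Z = V \<inter> closure Z" using ZV closure_subset by blast
      then show "closedin (top_of_set V) Z" by (metis closedin_closed closed_closure)
    qed
  qed
  moreover have "A \<subseteq> Z" unfolding Z_def using A by (intro interior_maximal) auto
  ultimately show ?thesis using A(2) z interior_subset unfolding Z_def by blast
qed

text \<open>The definition of \<open>hol_functions\<close> asks for pointwise differentiability only. Cauchy's estimate on
  discs in the direction \<open>v\<close> bounds the difference of two derivatives by the oscillation of \<open>f\<close>, which
  is small by uniform continuity; so \<open>f\<close> is automatically of class \<open>C\<^sup>1\<close>, as is needed to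
  differentiate under integral signs below.\<close>

lemma hol_functions_continuous_derivative:
  fixes v :: "complex ^ 'n::finite"
  assumes U: "open U" and f: "f \<in> hol_functions U"
  shows "continuous_on U (\<lambda>z. frechet_derivative f (at z) v)"
proof (cases "v = 0")
  case True
  have "frechet_derivative f (at z) v = 0" if "z \<in> U" for z
    using hol_functions_frechet(2)[OF f that, of 0 v] True by simp
  then show ?thesis by (simp add: continuous_on_eq[OF continuous_on_const[of _ 0]])
next
  case False
  show ?thesis unfolding continuous_on_iff
  proof (intro ballI allI impI)
    fix z and e :: real assume z: "z \<in> U" and e: "e > 0"
    obtain d where d: "d > 0" "cball z d \<subseteq> U" using U z open_contains_cball by blast
    define \<rho> where "\<rho> = d / (2 * norm v)"
    have \<rho>: "\<rho> > 0" using d False by (simp add: \<rho>_def)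
    have inside: "w + t *s v \<in> cball z d" if "dist w z \<le> d/2" "cmod t \<le> \<rho>" for w t
    proof -
      have "norm (t *s v) = cmod t * norm v"
        by (simp add: norm_vec_def L2_set_def norm_mult power_mult_distrib
            sum_distrib_left[symmetric] real_sqrt_mult)
      also have "\<dots> \<le> \<rho> * norm v" using that by (intro mult_right_mono) auto
      also have "\<dots> = d/2" using False by (simp add: \<rho>_def)
      finally have "norm (t *s v) \<le> d/2" .
      then show ?thesis using that norm_triangle_ineq[of "w - z" "t *s v"]
        by (simp add: dist_norm norm_minus_commute[of z] algebra_simps)
    qed
    have "uniformly_continuous_on (cball z d) f"
      by (rule compact_uniformly_continuous[OF
            continuous_on_subset[OF hol_functions_continuous_on[OF f] d(2)] compact_cball])
    moreover have "e * \<rho> / 2 > 0" using e \<rho> by simp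
    ultimately obtain \<eta> where \<eta>: "\<eta> > 0"
      "\<And>x y. x \<in> cball z d \<Longrightarrow> y \<in> cball z d \<Longrightarrow> dist y x < \<eta> \<Longrightarrow> dist (f y) (f x) < e * \<rho> / 2"
      unfolding uniformly_continuous_on_def by blast
    show "\<exists>\<delta>>0. \<forall>w\<in>U. dist w z < \<delta> \<longrightarrow>
        dist (frechet_derivative f (at w) v) (frechet_derivative f (at z) v) < e"
    proof (intro exI conjI ballI impI)
      show "min \<eta> (d/2) > 0" using \<eta> d by simp
      fix w assume w: "w \<in> U" "dist w z < min \<eta> (d/2)"
      define q where "q t = f (w + t *s v) - f (z + t *s v)" for t
      have zz: "dist z z \<le> d/2" and ww: "dist w z \<le> d/2" using d w by auto
      have der: "(q has_field_derivative
          (frechet_derivative f (at (w + t *s v)) v - frechet_derivative f (at (z + t *s v)) v)) (at t)"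
        if "t \<in> cball 0 \<rho>" for t
        unfolding q_def
        using inside[OF zz] inside[OF ww] that d
        by (intro DERIV_diff hol_functions_line[OF f]) auto
      have cont: "continuous_on (cball 0 \<rho>) q"
        by (meson der DERIV_isCont continuous_at_imp_continuous_on)
      have hol: "q holomorphic_on ball 0 \<rho>"
        by (meson der holomorphic_on_open open_ball ball_subset_cball subsetD)
      have "cmod ((deriv ^^ 1) q 0) \<le> fact 1 * (e * \<rho> / 2) / \<rho> ^ 1"
      proof (rule Cauchy_inequality[OF hol cont \<rho>])
        fix t assume "cmod (0 - t) = \<rho>"
        then have "cmod t \<le> \<rho>" by simp
        then have "w + t *s v \<in> cball z d" "z + t *s v \<in> cball z d"
          using inside[OF zz] inside[OF ww] by auto
        moreover have "dist (w + t *s v) (z + t *s v) < \<eta>" using w by (simp add: dist_norm)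
        ultimately show "cmod (q t) \<le> e * \<rho> / 2"
          using \<eta>(2) by (metis dist_norm less_imp_le q_def)
      qed
      moreover have "deriv q 0 = frechet_derivative f (at w) v - frechet_derivative f (at z) v"
        using DERIV_imp_deriv[OF der[of 0]] \<rho> by simp
      ultimately show "dist (frechet_derivative f (at w) v) (frechet_derivative f (at z) v) < e"
        using e \<rho> by (simp add: dist_norm)
    qed
  qed
qed

section \<open>The Cauchy transform along a coordinate axis\<close>

definition C1_deriv :: "(complex ^ 'n::finite) set \<Rightarrow> (complex ^ 'n \<Rightarrow> complex) \<Rightarrow>
    (complex ^ 'n \<Rightarrow> complex ^ 'n \<Rightarrow> complex) \<Rightarrow> bool" where
  "C1_deriv S g g' \<longleftrightarrow>
     (\<forall>z\<in>S. (g has_derivative g' z) (at z)) \<and> (\<forall>v. continuous_on S (\<lambda>z. g' z v))"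

text \<open>Applied to the real differential of \<open>f\<close> at a point, this is the Wirtinger derivative with
  respect to the conjugate of \<open>z\<^sub>j\<close>.\<close>

definition dbar :: "'n \<Rightarrow> (complex ^ 'n::finite \<Rightarrow> complex) \<Rightarrow> complex" where
  "dbar j A = (A (axis j 1) + \<i> * A (axis j \<i>)) / 2"

lemma axis_scaleR: "axis j (r *\<^sub>R t) = r *\<^sub>R (axis j t :: complex ^ 'n::finite)"
  and axis_plus: "axis j (s + t) = axis j s + (axis j t :: complex ^ 'n::finite)"
  by (simp_all add: axis_def vec_eq_iff)

lemma bounded_linear_axis_right: "bounded_linear (axis j :: complex \<Rightarrow> complex ^ 'n::finite)"
  by (rule linear_conv_bounded_linear[THEN iffD1], rule linearI) (simp_all add: axis_scaleR axis_plus)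

lemma linear_axis_decomp:
  fixes A :: "complex ^ 'n::finite \<Rightarrow> complex"
  assumes "linear A"
  shows "A (axis j t) = Re t * A (axis j 1) + Im t * A (axis j \<i>)"
proof -
  have "t = Re t *\<^sub>R 1 + Im t *\<^sub>R \<i>" by (simp add: complex_eq_iff)
  then have "axis j t = Re t *\<^sub>R axis j 1 + Im t *\<^sub>R (axis j \<i> :: complex ^ 'n)"
    by (metis axis_scaleR axis_plus)
  then show ?thesis
    by (simp add: linear_add[OF assms] linear_scale[OF assms] scaleR_conv_of_real[where 'a=complex])
qed

text \<open>The Cauchy-Riemann equations: this turns vanishing Wirtinger derivatives into the complex
  linearity that \<open>hol_functions\<close> demands.\<close>

lemma linear_dbar_zero:
  fixes A :: "complex ^ 'n::finite \<Rightarrow> complex"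
  assumes lin: "linear A" and d: "\<And>j. dbar j A = 0"
  shows "A (c *s v) = c * A v"
proof -
  have Ai: "A (axis j \<i>) = \<i> * A (axis j 1)" for j
  proof -
    have "\<i> * (A (axis j 1) + \<i> * A (axis j \<i>)) = 0" using d[of j] by (simp add: dbar_def)
    then show ?thesis by (simp add: distrib_left)
  qed
  have Aax: "A (axis j t) = t * A (axis j 1)" for j t
  proof -
    have "A (axis j t) = (of_real (Re t) + \<i> * of_real (Im t)) * A (axis j 1)"
      using linear_axis_decomp[OF lin, of j t] by (simp add: Ai distrib_right mult.left_commute)
    then show ?thesis by (simp flip: complex_eq)
  qed
  have dec: "A u = (\<Sum>j\<in>UNIV. u $ j * A (axis j 1))" for u
  proof -
    have "(\<Sum>j\<in>UNIV. axis j (u $ j)) = u" by (simp add: vec_eq_iff axis_def)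
    moreover have "A (\<Sum>j\<in>UNIV. axis j (u $ j)) = (\<Sum>j\<in>UNIV. A (axis j (u $ j)))"
      by (rule linear_sum[OF lin])
    moreover have "\<dots> = (\<Sum>j\<in>UNIV. u $ j * A (axis j 1))"
      by (rule sum.cong[OF refl Aax])
    ultimately show ?thesis by simp
  qed
  show ?thesis
    unfolding dec[of "c *s v"] dec[of v] by (simp add: sum_distrib_left mult.assoc)
qed

text \<open>In polar coordinates \<open>\<zeta> = r e\<^sup>i\<^sup>\<theta>\<close> the kernel \<open>1/\<zeta>\<close> becomes \<open>e\<^sup>-\<^sup>i\<^sup>\<theta>/r\<close>, and its
  singularity is cancelled by the area element \<open>r dr d\<theta>\<close>. So this is the integral of
  \<open>g (z + \<zeta> e\<^sub>j) / \<zeta>\<close> over the disc of radius \<open>R\<close>, written with a continuous integrand on a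
  rectangle; neither singular integrals nor a change of variables ever occur.\<close>

definition cauchy_transform :: "'n \<Rightarrow> real \<Rightarrow> (complex ^ 'n::finite \<Rightarrow> complex) \<Rightarrow> complex ^ 'n \<Rightarrow> complex" where
  "cauchy_transform j R g z =
     integral (cbox (0, 0) (R, 2 * pi)) (\<lambda>(r, \<theta>). g (z + axis j (r *\<^sub>R cis \<theta>)) * cis (- \<theta>))"

lemma continuous_on_polar:
  fixes g :: "complex ^ 'n::finite \<Rightarrow> complex"
  assumes "continuous_on UNIV g"
  shows "continuous_on S (\<lambda>(z, r, \<theta>). g (z + axis j (r *\<^sub>R cis \<theta>)) * cis (- \<theta>))"
proof -
  have "continuous_on S (\<lambda>(z, r, \<theta>). z + axis j (r *\<^sub>R cis \<theta>))"
    unfolding split_beta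
    by (intro continuous_intros bounded_linear.continuous_on[OF bounded_linear_axis_right])
  from continuous_on_compose2[OF assms this]
  show ?thesis unfolding split_beta by (auto intro!: continuous_intros)
qed

lemma cauchy_transform_integrable:
  fixes g :: "complex ^ 'n::finite \<Rightarrow> complex" and a b c d :: real
  assumes "continuous_on UNIV g"
  shows "(\<lambda>(r, \<theta>). g (z + axis j (r *\<^sub>R cis \<theta>)) * cis (- \<theta>)) integrable_on cbox (a, b) (c, d)"
proof (rule integrable_continuous)
  have "continuous_on (cbox (a,b) (c,d)) (\<lambda>x. (z, x))" by (intro continuous_intros)
  from continuous_on_compose2[OF continuous_on_polar[OF assms, of UNIV j] this]
  show "continuous_on (cbox (a,b) (c,d)) (\<lambda>(r, \<theta>). g (z + axis j (r *\<^sub>R cis \<theta>)) * cis (- \<theta>))"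
    by (simp add: split_beta)
qed

lemma cauchy_transform_has_derivative:
  fixes g :: "complex ^ 'n::finite \<Rightarrow> complex"
  assumes "C1_deriv UNIV g g'"
  shows "(cauchy_transform j R g has_derivative (\<lambda>v. cauchy_transform j R (\<lambda>w. g' w v) z)) (at z)"
proof -
  have der: "\<And>w. (g has_derivative g' w) (at w)" and cont: "\<And>v. continuous_on UNIV (\<lambda>w. g' w v)"
    using assms by (auto simp: C1_deriv_def)
  have contg: "continuous_on UNIV g"
    by (meson der continuous_at_imp_continuous_on has_derivative_continuous)
  define \<Phi> where "\<Phi> w = (\<lambda>(r::real, \<theta>). Blinfun (\<lambda>v. g' (w + axis j (r *\<^sub>R cis \<theta>)) v * cis (- \<theta>)))" for w
  have \<Phi>: "blinfun_apply (\<Phi> w (r, \<theta>)) v = g' (w + axis j (r *\<^sub>R cis \<theta>)) v * cis (- \<theta>)" for w r \<theta> v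
    unfolding \<Phi>_def
    by (simp add: bounded_linear_Blinfun_apply bounded_linear_compose[OF bounded_linear_mult_left]
          has_derivative_bounded_linear[OF der])
  have cont\<Phi>: "continuous_on S (\<lambda>(w, x). \<Phi> w x)" for S
  proof (rule continuous_on_blinfun_componentwise)
    fix v :: "complex ^ 'n"
    show "continuous_on S (\<lambda>x. blinfun_apply (case x of (w, x) \<Rightarrow> \<Phi> w x) v)"
      using continuous_on_polar[OF cont[of v], of S j]
      by (rule continuous_on_eq) (auto simp: \<Phi>)
  qed
  have "((\<lambda>w. integral (cbox (0, 0) (R, 2 * pi)) (\<lambda>(r, \<theta>). g (w + axis j (r *\<^sub>R cis \<theta>)) * cis (- \<theta>)))
      has_derivative integral (cbox (0, 0) (R, 2 * pi)) (\<Phi> z)) (at z within UNIV)"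
  proof (rule leibniz_rule)
    fix w :: "complex ^ 'n" and x :: "real \<times> real"
    obtain r \<theta> where x: "x = (r, \<theta>)" by force
    have "((\<lambda>w. w + axis j (r *\<^sub>R cis \<theta>)) has_derivative (\<lambda>v. v)) (at w)"
      by (auto intro!: derivative_eq_intros)
    from has_derivative_compose[OF this der]
    have "((\<lambda>w. g (w + axis j (r *\<^sub>R cis \<theta>)) * cis (- \<theta>)) has_derivative
       (\<lambda>v. g' (w + axis j (r *\<^sub>R cis \<theta>)) v * cis (- \<theta>))) (at w)"
      by (rule has_derivative_mult_left)
    then show "((\<lambda>w. case x of (r, \<theta>) \<Rightarrow> g (w + axis j (r *\<^sub>R cis \<theta>)) * cis (- \<theta>)) has_derivative
       blinfun_apply (\<Phi> w x)) (at w within UNIV)"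
      unfolding x prod.case \<Phi>[THEN ext, symmetric] .
  next
    show "continuous_on (UNIV \<times> cbox (0, 0) (R, 2 * pi)) (\<lambda>(w, x). \<Phi> w x)" by (rule cont\<Phi>)
  qed (use cauchy_transform_integrable[OF contg] in auto)
  moreover have "blinfun_apply (integral (cbox (0, 0) (R, 2 * pi)) (\<Phi> z)) v
      = cauchy_transform j R (\<lambda>w. g' w v) z" for v
  proof -
    have "continuous_on (cbox (0, 0) (R, 2 * pi)) (\<lambda>x. (z, x))" by (intro continuous_intros)
    from continuous_on_compose2[OF cont\<Phi>[of UNIV] this]
    have "\<Phi> z integrable_on cbox (0, 0) (R, 2 * pi)" by (intro integrable_continuous) simp
    moreover have "blinfun_apply (\<Phi> z x) v = (case x of (r, \<theta>) \<Rightarrow> g' (z + axis j (r *\<^sub>R cis \<theta>)) v * cis (- \<theta>))" for x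
      by (cases x) (simp add: \<Phi>)
    ultimately show ?thesis unfolding cauchy_transform_def by (simp add: blinfun_apply_integral)
  qed
  ultimately show ?thesis
    unfolding cauchy_transform_def[abs_def] by (simp add: has_derivative_eq_rhs fun_eq_iff)
qed

lemma cauchy_transform_combination:
  fixes g h :: "complex ^ 'n::finite \<Rightarrow> complex"
  assumes "continuous_on UNIV g" "continuous_on UNIV h"
  shows "cauchy_transform j R (\<lambda>w. (g w + \<i> * h w) / 2) z
       = (cauchy_transform j R g z + \<i> * cauchy_transform j R h z) / 2"
proof -
  have "cauchy_transform j R (\<lambda>w. (g w + \<i> * h w) / 2) z
    = integral (cbox (0, 0) (R, 2 * pi)) (\<lambda>x. (1/2) * (case x of (r, \<theta>) \<Rightarrow> g (z + axis j (r *\<^sub>R cis \<theta>)) * cis (- \<theta>))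
        + (\<i>/2) * (case x of (r, \<theta>) \<Rightarrow> h (z + axis j (r *\<^sub>R cis \<theta>)) * cis (- \<theta>)))"
    unfolding cauchy_transform_def
    by (intro arg_cong[where f = "integral _"] ext) (auto simp: field_simps)
  also have "\<dots> = (1/2) * cauchy_transform j R g z + (\<i>/2) * cauchy_transform j R h z"
    unfolding cauchy_transform_def
    using cauchy_transform_integrable[OF assms(1)] cauchy_transform_integrable[OF assms(2)]
    by (subst integral_add) (auto intro: integrable_on_mult_right)
  finally show ?thesis by (simp add: field_simps)
qed

lemma dbar_cauchy_transform:
  fixes g :: "complex ^ 'n::finite \<Rightarrow> complex"
  assumes "C1_deriv UNIV g g'"
  shows "dbar i (\<lambda>v. cauchy_transform j R (\<lambda>w. g' w v) z) = cauchy_transform j R (\<lambda>w. dbar i (g' w)) z"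
  unfolding dbar_def using assms
  by (subst cauchy_transform_combination) (auto simp: C1_deriv_def)

text \<open>The Cauchy-Pompeiu formula. Up to the factor 2, \<open>e\<^sup>-\<^sup>i\<^sup>\<theta> \<cdot> dbar\<close> is the radial derivative
  plus \<open>\<i>/r\<close> times the angular derivative. The radial part integrates to minus the value at the
  centre, as the function vanishes on the bounding circle, and the angular part integrates to zero over each
  circle by periodicity.\<close>

lemma cauchy_transform_dbar:
  fixes g :: "complex ^ 'n::finite \<Rightarrow> complex"
  assumes C1: "C1_deriv UNIV g g'" and R: "R \<ge> 0"
    and zero: "\<And>t. cmod t = R \<Longrightarrow> g (z + axis j t) = 0"
  shows "cauchy_transform j R (\<lambda>w. dbar j (g' w)) z = - pi * g z"
proof -
  have der: "\<And>w. (g has_derivative g' w) (at w)" and cont: "\<And>v. continuous_on UNIV (\<lambda>w. g' w v)"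
    using C1 by (auto simp: C1_deriv_def)
  define pt where "pt r \<theta> = z + axis j (r *\<^sub>R cis \<theta>)" for r \<theta>
  have contpt: "continuous_on S (\<lambda>(r, \<theta>). pt r \<theta>)" for S
    unfolding pt_def split_beta
    by (intro continuous_intros bounded_linear.continuous_on[OF bounded_linear_axis_right])
  \<comment> \<open>\<open>A\<close> is the radial derivative and \<open>B\<close> the angular derivative divided by \<open>r\<close>; both are
    continuous up to \<open>r = 0\<close>.\<close>
  define A where "A r \<theta> = g' (pt r \<theta>) (axis j (cis \<theta>))" for r \<theta>
  define B where "B r \<theta> = g' (pt r \<theta>) (axis j (\<i> * cis \<theta>))" for r \<theta>
  have lin: "linear (g' w)" for w by (rule has_derivative_linear[OF der])
  have Aeq: "A r \<theta> = of_real (cos \<theta>) * g' (pt r \<theta>) (axis j 1) + of_real (sin \<theta>) * g' (pt r \<theta>) (axis j \<i>)"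
    and Beq: "B r \<theta> = of_real (cos \<theta>) * g' (pt r \<theta>) (axis j \<i>) - of_real (sin \<theta>) * g' (pt r \<theta>) (axis j 1)" for r \<theta>
    unfolding A_def B_def
    using linear_axis_decomp[OF lin, of "pt r \<theta>" j "cis \<theta>"]
      linear_axis_decomp[OF lin, of "pt r \<theta>" j "\<i> * cis \<theta>"] by simp_all
  have contg': "continuous_on S (\<lambda>x. g' (pt (fst x) (snd x)) v)" for S v
    using continuous_on_compose2[OF cont contpt] by (simp add: split_beta)
  have contA: "continuous_on S (\<lambda>(r, \<theta>). A r \<theta>)" and contB: "continuous_on S (\<lambda>(r, \<theta>). B r \<theta>)" for S
    unfolding Aeq Beq split_beta
    by (intro continuous_intros contg')+
  have AB: "dbar j (g' (pt r \<theta>)) * cis (- \<theta>) = (A r \<theta> + \<i> * B r \<theta>) / 2" for r \<theta>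
    unfolding Aeq Beq dbar_def cis.ctr by (simp add: complex_eq_iff field_simps)
  have derpt1: "((\<lambda>r. g (pt r \<theta>)) has_vector_derivative A r \<theta>) (at r within T)" for r \<theta> T
  proof -
    have "((\<lambda>r. pt r \<theta>) has_derivative (\<lambda>h. axis j (h *\<^sub>R cis \<theta>))) (at r within T)"
      unfolding pt_def
      by (rule has_derivative_eq_rhs, rule has_derivative_add[OF has_derivative_const
           bounded_linear.has_derivative[OF bounded_linear_axis_right]],
          rule has_derivative_scaleR_left[OF has_derivative_ident]) simp
    from has_derivative_compose[OF this der]
    show ?thesis unfolding has_vector_derivative_def A_def
      by (rule has_derivative_eq_rhs) (simp add: axis_scaleR linear_scale[OF lin])
  qed
  have derpt2: "((\<lambda>\<theta>. g (pt r \<theta>)) has_vector_derivative r *\<^sub>R B r \<theta>) (at \<theta> within T)" for r \<theta> T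
  proof -
    have "(cis has_derivative (\<lambda>h. h *\<^sub>R (\<i> * cis \<theta>))) (at \<theta> within T)"
      by (rule has_derivative_at_withinI) (auto intro!: derivative_eq_intros simp: scaleR_conv_of_real)
    then have "((\<lambda>\<theta>. pt r \<theta>) has_derivative (\<lambda>h. axis j (r *\<^sub>R h *\<^sub>R (\<i> * cis \<theta>)))) (at \<theta> within T)"
      unfolding pt_def
      by (intro has_derivative_eq_rhs[OF has_derivative_add[OF has_derivative_const
           bounded_linear.has_derivative[OF bounded_linear_axis_right
             has_derivative_scaleR_right]]]) auto
    from has_derivative_compose[OF this der]
    show ?thesis unfolding has_vector_derivative_def B_def
      by (rule has_derivative_eq_rhs) (simp add: axis_scaleR linear_scale[OF lin] mult.commute)
  qed
  have intA: "integral {0..R} (\<lambda>r. A r \<theta>) = - g z" for \<theta>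
  proof -
    have "((\<lambda>r. A r \<theta>) has_integral (g (pt R \<theta>) - g (pt 0 \<theta>))) {0..R}"
      by (rule fundamental_theorem_of_calculus[OF R derpt1])
    moreover have "g (pt R \<theta>) = 0" unfolding pt_def by (rule zero) (use R in simp)
    moreover have "pt 0 \<theta> = z" by (simp add: pt_def axis_def vec_eq_iff)
    ultimately show ?thesis by (simp add: integral_unique)
  qed
  have intB: "integral {0..2*pi} (\<lambda>\<theta>. B r \<theta>) = 0" if "r \<noteq> 0" for r
  proof -
    have *: "((\<lambda>\<theta>. r *\<^sub>R B r \<theta>) has_integral (g (pt r (2*pi)) - g (pt r 0))) {0..2*pi}"
      by (rule fundamental_theorem_of_calculus[OF _ derpt2]) simp
    have "pt r (2*pi) = pt r 0" by (simp add: pt_def)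
    with integral_unique[OF *] have "integral {0..2*pi} (\<lambda>\<theta>. r *\<^sub>R B r \<theta>) = 0"
      by simp
    then have "r *\<^sub>R integral {0..2*pi} (\<lambda>\<theta>. B r \<theta>) = 0"
      by (simp only: integral_cmul)
    then show ?thesis using that by simp
  qed
  have IA: "integral (cbox (0, 0) (R, 2*pi)) (\<lambda>(r, \<theta>). A r \<theta>) = - 2 * pi * g z"
  proof -
    have "integral (cbox (0, 0) (R, 2*pi)) (\<lambda>(r, \<theta>). A r \<theta>)
        = integral {0..2*pi} (\<lambda>\<theta>. integral {0..R} (\<lambda>r. A r \<theta>))"
      using integral_prod_continuous[OF contA, of 0 0 R "2*pi"]
        integral_swap_continuous[of 0 0 R "2*pi" A, OF contA] by simp
    also have "\<dots> = - 2 * pi * g z"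
      by (simp add: intA scaleR_conv_of_real)
    finally show ?thesis .
  qed
  have IB: "integral (cbox (0, 0) (R, 2*pi)) (\<lambda>(r, \<theta>). B r \<theta>) = 0"
  proof -
    have "integral (cbox (0, 0) (R, 2*pi)) (\<lambda>(r, \<theta>). B r \<theta>)
        = integral {0..R} (\<lambda>r. integral {0..2*pi} (\<lambda>\<theta>. B r \<theta>))"
      using integral_prod_continuous[OF contB, of 0 0 R "2*pi"] by simp
    also have "\<dots> = integral {0..R} (\<lambda>r. 0)"
      by (rule integral_spike[of "{0}"]) (auto simp: intB)
    finally show ?thesis by simp
  qed
  have "cauchy_transform j R (\<lambda>w. dbar j (g' w)) z
     = integral (cbox (0, 0) (R, 2*pi)) (\<lambda>(r, \<theta>). (A r \<theta> + \<i> * B r \<theta>) / 2)"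
    unfolding cauchy_transform_def by (simp add: AB flip: pt_def)
  also have "\<dots> = integral (cbox (0, 0) (R, 2*pi))
       (\<lambda>x. (1/2) * (case x of (r, \<theta>) \<Rightarrow> A r \<theta>) + (\<i>/2) * (case x of (r, \<theta>) \<Rightarrow> B r \<theta>))"
    by (intro arg_cong[where f = "integral _"] ext) (auto simp: add_divide_distrib)
  also have "\<dots> = (1/2) * integral (cbox (0, 0) (R, 2*pi)) (\<lambda>(r, \<theta>). A r \<theta>)
        + (\<i>/2) * integral (cbox (0, 0) (R, 2*pi)) (\<lambda>(r, \<theta>). B r \<theta>)"
    by (subst integral_add) (auto intro!: integrable_on_mult_right integrable_continuous contA contB)
  finally show ?thesis by (simp add: IA IB)
qed

section \<open>Cutoff functions with explicit complex derivatives\<close>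

text \<open>Twice continuously differentiable real functions, recorded by their Wirtinger derivatives \<open>s j\<close>.
  The last clause is the symmetry of the mixed second derivatives. Carrying it along through explicit
  constructions replaces the general theorem on mixed derivatives.\<close>

definition C2_dbar :: "(complex ^ 'n::finite \<Rightarrow> real) \<Rightarrow> ('n \<Rightarrow> complex ^ 'n \<Rightarrow> complex) \<Rightarrow> bool" where
  "C2_dbar \<sigma> s \<longleftrightarrow> (\<exists>\<sigma>' s'.
     (\<forall>z. (\<sigma> has_derivative \<sigma>' z) (at z)) \<and> (\<forall>v. continuous_on UNIV (\<lambda>z. \<sigma>' z v)) \<and>
     (\<forall>j z. dbar j (\<lambda>v. of_real (\<sigma>' z v)) = s j z) \<and>
     (\<forall>j. C1_deriv UNIV (s j) (s' j)) \<and>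
     (\<forall>i j z. dbar i (s' j z) = dbar j (s' i z)))"

lemma C2_dbar_norm_sq: "C2_dbar (\<lambda>z. (norm (z - c))\<^sup>2) (\<lambda>j z. (z - c) $ j)"
  unfolding C2_dbar_def
proof (intro exI conjI allI)
  fix z v :: "complex ^ 'a" and i j
  show "((\<lambda>z. (norm (z - c))\<^sup>2) has_derivative (\<lambda>v. 2 * ((z - c) \<bullet> v))) (at z)"
    unfolding power2_norm_eq_inner
    by (auto intro!: derivative_eq_intros simp: inner_commute)
  show "continuous_on UNIV (\<lambda>z. 2 * ((z - c) \<bullet> v))" by (intro continuous_intros)
  show "dbar j (\<lambda>v. of_real (2 * ((z - c) \<bullet> v))) = (z - c) $ j"
    by (simp add: dbar_def inner_axis complex_eq_iff)
  show "C1_deriv UNIV (\<lambda>z. (z - c) $ j) (\<lambda>z v. v $ j)"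
    unfolding C1_deriv_def
    by (auto intro!: derivative_eq_intros bounded_linear_vec_nth[THEN bounded_linear.has_derivative])
  show "dbar i (\<lambda>v. v $ j) = dbar j (\<lambda>v. v $ i)"
    by (auto simp: dbar_def axis_def)
qed

lemma C2_dbar_sum:
  assumes "finite C" "\<And>c. c \<in> C \<Longrightarrow> C2_dbar (\<sigma> c) (s c)"
  shows "C2_dbar (\<lambda>z. \<Sum>c\<in>C. \<sigma> c z) (\<lambda>j z. \<Sum>c\<in>C. s c j z)"
proof -
  obtain \<sigma>' s' where
    1: "\<And>c z. c \<in> C \<Longrightarrow> (\<sigma> c has_derivative \<sigma>' c z) (at z)"
    and 2: "\<And>c v. c \<in> C \<Longrightarrow> continuous_on UNIV (\<lambda>z. \<sigma>' c z v)"
    and 3: "\<And>c j z. c \<in> C \<Longrightarrow> dbar j (\<lambda>v. of_real (\<sigma>' c z v)) = s c j z"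
    and 4: "\<And>c j. c \<in> C \<Longrightarrow> C1_deriv UNIV (s c j) (s' c j)"
    and 5: "\<And>c i j z. c \<in> C \<Longrightarrow> dbar i (s' c j z) = dbar j (s' c i z)"
    using assms(2) unfolding C2_dbar_def by metis
  have dbar_sum: "dbar j (\<lambda>v. \<Sum>c\<in>C. A c v) = (\<Sum>c\<in>C. dbar j (A c))" for j and A :: "_ \<Rightarrow> complex ^ 'b \<Rightarrow> complex"
    unfolding dbar_def sum_divide_distrib[symmetric] sum.distrib sum_distrib_left[symmetric] ..
  show ?thesis unfolding C2_dbar_def
  proof (intro exI conjI allI)
    fix z v i j
    show "((\<lambda>z. \<Sum>c\<in>C. \<sigma> c z) has_derivative (\<lambda>v. \<Sum>c\<in>C. \<sigma>' c z v)) (at z)"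
      by (intro has_derivative_sum 1)
    show "continuous_on UNIV (\<lambda>z. \<Sum>c\<in>C. \<sigma>' c z v)" by (intro continuous_on_sum 2)
    show "dbar j (\<lambda>v. of_real (\<Sum>c\<in>C. \<sigma>' c z v)) = (\<Sum>c\<in>C. s c j z)"
      by (simp add: dbar_sum 3)
    show "C1_deriv UNIV (\<lambda>z. \<Sum>c\<in>C. s c j z) (\<lambda>z v. \<Sum>c\<in>C. s' c j z v)"
      using 4 unfolding C1_deriv_def by (auto intro!: has_derivative_sum continuous_on_sum)
    show "dbar i (\<lambda>v. \<Sum>c\<in>C. s' c j z v) = dbar j (\<lambda>v. \<Sum>c\<in>C. s' c i z v)"
      by (simp add: dbar_sum 5)
  qed
qed

lemma C2_dbar_compose:
  assumes "C2_dbar \<sigma> s"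
    and \<Phi>: "\<And>x. (\<Phi> has_real_derivative \<Phi>' x) (at x)" "\<And>x. (\<Phi>' has_real_derivative \<Phi>'' x) (at x)"
      "continuous_on UNIV \<Phi>''"
  shows "C2_dbar (\<lambda>z. \<Phi> (\<sigma> z)) (\<lambda>j z. of_real (\<Phi>' (\<sigma> z)) * s j z)"
proof -
  obtain \<sigma>' s' where
    1: "\<And>z. (\<sigma> has_derivative \<sigma>' z) (at z)"
    and 2: "\<And>v. continuous_on UNIV (\<lambda>z. \<sigma>' z v)"
    and 3: "\<And>j z. dbar j (\<lambda>v. of_real (\<sigma>' z v)) = s j z"
    and 4: "\<And>j. C1_deriv UNIV (s j) (s' j)"
    and 5: "\<And>i j z. dbar i (s' j z) = dbar j (s' i z)"
    using assms(1) unfolding C2_dbar_def by metis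
  have c\<sigma>: "continuous_on UNIV \<sigma>"
    by (meson 1 continuous_at_imp_continuous_on has_derivative_continuous)
  have c\<Phi>': "continuous_on UNIV \<Phi>'"
    by (meson \<Phi>(2) DERIV_isCont continuous_at_imp_continuous_on)
  have cs: "continuous_on UNIV (s j)" for j
    using 4[of j] unfolding C1_deriv_def
    by (meson continuous_at_imp_continuous_on has_derivative_continuous)
  have chain: "((\<lambda>z. \<Psi> (\<sigma> z)) has_derivative (\<lambda>v. D * \<sigma>' z v)) (at z)"
    if "(\<Psi> has_real_derivative D) (at (\<sigma> z))" for \<Psi> D z
    using has_derivative_compose[OF 1 that[unfolded has_field_derivative_def]] by simp
  show ?thesis unfolding C2_dbar_def
  proof (intro exI conjI allI)
    fix z v i j
    show "((\<lambda>z. \<Phi> (\<sigma> z)) has_derivative (\<lambda>v. \<Phi>' (\<sigma> z) * \<sigma>' z v)) (at z)"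
      by (rule chain[OF \<Phi>(1)])
    show "continuous_on UNIV (\<lambda>z. \<Phi>' (\<sigma> z) * \<sigma>' z v)"
      by (intro continuous_intros 2 continuous_on_compose2[OF c\<Phi>' c\<sigma>]) auto
    show "dbar j (\<lambda>v. of_real (\<Phi>' (\<sigma> z) * \<sigma>' z v)) = of_real (\<Phi>' (\<sigma> z)) * s j z"
      unfolding 3[symmetric] dbar_def by (simp add: algebra_simps)
    show "C1_deriv UNIV (\<lambda>z. of_real (\<Phi>' (\<sigma> z)) * s j z)
       (\<lambda>z v. of_real (\<Phi>' (\<sigma> z)) * s' j z v + of_real (\<Phi>'' (\<sigma> z) * \<sigma>' z v) * s j z)"
      unfolding C1_deriv_def
    proof (intro conjI ballI allI)
      fix z v
      show "((\<lambda>z. of_real (\<Phi>' (\<sigma> z)) * s j z) has_derivative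
         (\<lambda>v. of_real (\<Phi>' (\<sigma> z)) * s' j z v + of_real (\<Phi>'' (\<sigma> z) * \<sigma>' z v) * s j z)) (at z)"
        using 4[of j] unfolding C1_deriv_def
        by (intro has_derivative_mult has_derivative_of_real chain[OF \<Phi>(2)]) auto
      show "continuous_on UNIV
         (\<lambda>z. of_real (\<Phi>' (\<sigma> z)) * s' j z v + of_real (\<Phi>'' (\<sigma> z) * \<sigma>' z v) * s j z)"
        using 4[of j] unfolding C1_deriv_def
        by (intro continuous_intros 2 cs continuous_on_compose2[OF c\<Phi>' c\<sigma>]
              continuous_on_compose2[OF \<Phi>(3) c\<sigma>]) auto
    qed
    have "dbar i (\<lambda>v. of_real (\<Phi>' (\<sigma> z)) * s' j z v + of_real (\<Phi>'' (\<sigma> z) * \<sigma>' z v) * s j z)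
       = of_real (\<Phi>' (\<sigma> z)) * dbar i (s' j z) + of_real (\<Phi>'' (\<sigma> z)) * s i z * s j z" for i j
      unfolding 3[of i z, symmetric] dbar_def by (simp add: field_simps)
    then show "dbar i (\<lambda>v. of_real (\<Phi>' (\<sigma> z)) * s' j z v + of_real (\<Phi>'' (\<sigma> z) * \<sigma>' z v) * s j z)
       = dbar j (\<lambda>v. of_real (\<Phi>' (\<sigma> z)) * s' i z v + of_real (\<Phi>'' (\<sigma> z) * \<sigma>' z v) * s i z)"
      by (simp add: 5[of i j])
  qed
qed

text \<open>Powers of the positive part serve as elementary bump profiles; the cube is of class \<open>C\<^sup>2\<close>.\<close>

lemma has_real_derivative_max_power:
  assumes "m \<ge> 1"
  shows "((\<lambda>x. (max 0 x) ^ Suc m) has_real_derivative real (Suc m) * (max 0 x) ^ m) (at x)"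
proof -
  consider "x > 0" | "x < 0" | "x = 0" by linarith
  then show ?thesis
  proof cases
    case 1
    have "((\<lambda>x. x ^ Suc m) has_real_derivative real (Suc m) * x ^ m) (at x)"
      using DERIV_pow[of "Suc m" x] by simp
    then have "((\<lambda>x. (max 0 x) ^ Suc m) has_real_derivative real (Suc m) * x ^ m) (at x)"
      by (rule has_field_derivative_transform_within_open[where S = "{0<..}"]) (use 1 in auto)
    with 1 show ?thesis by simp
  next
    case 2
    have "((\<lambda>x. 0) has_real_derivative 0) (at x)" by simp
    then have "((\<lambda>x. (max 0 x) ^ Suc m) has_real_derivative 0) (at x)"
      by (rule has_field_derivative_transform_within_open[where S = "{..<0}"]) (use 2 in auto)
    with 2 assms show ?thesis by (simp add: power_0_left)
  next
    case 3
    have "((\<lambda>h. (max 0 h) ^ Suc m / h) \<longlongrightarrow> 0) (at (0::real))"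
    proof (rule Lim_null_comparison)
      have "norm ((max 0 h) ^ Suc m / h) \<le> \<bar>h\<bar> ^ m" for h :: real
        by (cases "h > 0") (auto simp: max_def)
      then show "\<forall>\<^sub>F h in at 0. norm ((max 0 h) ^ Suc m / h) \<le> \<bar>h\<bar> ^ m"
        by (simp add: always_eventually)
      have "((\<lambda>h::real. \<bar>h\<bar> ^ m) \<longlongrightarrow> \<bar>0\<bar> ^ m) (at 0)" by (intro tendsto_intros)
      then show "((\<lambda>h::real. \<bar>h\<bar> ^ m) \<longlongrightarrow> 0) (at 0)" using assms by (simp add: power_0_left)
    qed
    then show ?thesis using 3 assms by (simp add: has_field_derivative_iff power_0_left)
  qed
qed

lemma C2_dbar_cube:
  assumes "C2_dbar \<sigma> s"
  obtains s' where "C2_dbar (\<lambda>z. (max 0 (a - b * \<sigma> z)) ^ 3) s'"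
proof -
  have "C2_dbar (\<lambda>z. (max 0 (a - b * \<sigma> z)) ^ 3)
    (\<lambda>j z. of_real (- 3 * b * (max 0 (a - b * \<sigma> z))\<^sup>2) * s j z)"
  proof (rule C2_dbar_compose[OF assms,
     where \<Phi> = "\<lambda>x. (max 0 (a - b * x)) ^ 3" and \<Phi>' = "\<lambda>x. - 3 * b * (max 0 (a - b * x))\<^sup>2"
       and \<Phi>'' = "\<lambda>x. 6 * b\<^sup>2 * max 0 (a - b * x)"])
    fix x
    have l: "((\<lambda>x. a - b * x) has_real_derivative - b) (at x)"
      by (auto intro!: derivative_eq_intros)
    show "((\<lambda>x. (max 0 (a - b * x)) ^ 3) has_real_derivative - 3 * b * (max 0 (a - b * x))\<^sup>2) (at x)"
      using DERIV_chain2[OF has_real_derivative_max_power[of 2] l]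
      by (simp add: numeral_3_eq_3 numeral_2_eq_2 algebra_simps)
    show "((\<lambda>x. - 3 * b * (max 0 (a - b * x))\<^sup>2) has_real_derivative 6 * b\<^sup>2 * max 0 (a - b * x)) (at x)"
      using DERIV_cmult[OF DERIV_chain2[OF has_real_derivative_max_power[of 1] l], of "-3 * b"]
      by (simp add: power2_eq_square algebra_simps)
  qed (intro continuous_intros)
  then show ?thesis by (rule that)
qed

text \<open>Around each centre of a finite cover of \<open>K\<close> put the bump \<open>max 0 (2 - (norm (z - c))\<^sup>2/\<rho>\<^sup>2) ^ 3\<close>, which
  is at least \<open>1\<close> within distance \<open>\<rho>\<close> and vanishes beyond \<open>2 \<rho>\<close>. With \<open>\<sigma>\<close> the sum of the bumps,
  \<open>max 0 (1 - \<sigma>) ^ 3\<close> is the desired function.\<close>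

lemma C2_dbar_cutoff:
  fixes K G :: "(complex ^ 'n::finite) set"
  assumes K: "compact K" and G: "open G" "K \<subseteq> G"
  obtains \<omega> w N S where "C2_dbar \<omega> w" "open N" "K \<subseteq> N" "compact S" "S \<subseteq> G"
    "\<And>z. z \<in> N \<Longrightarrow> \<omega> z = 0" "\<And>z. z \<notin> S \<Longrightarrow> \<omega> z = 1"
proof -
  obtain d where d: "d > 0" "\<And>x. x \<in> K \<Longrightarrow> ball x d \<subseteq> G"
    using Heine_Borel_lemma[OF K, of "{G}"] G by auto
  define \<rho> where "\<rho> = d / 4"
  have \<rho>: "\<rho> > 0" "2 * \<rho> < d" using d by (auto simp: \<rho>_def)
  obtain C where C: "C \<subseteq> K" "finite C" "K \<subseteq> (\<Union>c\<in>C. ball c \<rho>)"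
    using compactE_image[OF K, of K "\<lambda>c. ball c \<rho>"] \<rho> by force
  have "\<exists>s. C2_dbar (\<lambda>z. (max 0 (2 - (1 / \<rho>\<^sup>2) * (norm (z - c))\<^sup>2)) ^ 3) s" for c :: "complex ^ 'n"
    using C2_dbar_cube[OF C2_dbar_norm_sq] by metis
  then obtain s where s: "\<And>c::complex^'n. C2_dbar (\<lambda>z. (max 0 (2 - (1 / \<rho>\<^sup>2) * (norm (z - c))\<^sup>2)) ^ 3) (s c)"
    by metis
  define \<sigma> where "\<sigma> z = (\<Sum>c\<in>C. (max 0 (2 - (1 / \<rho>\<^sup>2) * (norm (z - c))\<^sup>2)) ^ 3)" for z
  have "C2_dbar \<sigma> (\<lambda>j z. \<Sum>c\<in>C. s c j z)"
    unfolding \<sigma>_def by (rule C2_dbar_sum[OF C(2) s])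
  then obtain w where w: "C2_dbar (\<lambda>z. (max 0 (1 - 1 * \<sigma> z)) ^ 3) w"
    using C2_dbar_cube by metis
  show ?thesis
  proof (rule that[OF w, of "\<Union>c\<in>C. ball c \<rho>" "\<Union>c\<in>C. cball c (2 * \<rho>)"])
    show "(\<Union>c\<in>C. cball c (2 * \<rho>)) \<subseteq> G"
      using d(2) C(1) \<rho>(2) by (force simp: subset_iff)
    show "compact (\<Union>c\<in>C. cball c (2 * \<rho>))" using C(2) by (intro compact_UN) auto
    fix z
    show "(max 0 (1 - 1 * \<sigma> z)) ^ 3 = 0" if z: "z \<in> (\<Union>c\<in>C. ball c \<rho>)"
    proof -
      obtain c where c: "c \<in> C" "norm (z - c) < \<rho>"
        using z by (auto simp: dist_norm norm_minus_commute)
      then have "(norm (z - c))\<^sup>2 \<le> \<rho>\<^sup>2" by (intro power_mono) auto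
      then have "2 - (1 / \<rho>\<^sup>2) * (norm (z - c))\<^sup>2 \<ge> 1" using \<rho> by simp
      then have "1 \<le> (max 0 (2 - (1 / \<rho>\<^sup>2) * (norm (z - c))\<^sup>2)) ^ 3"
        by (intro one_le_power) simp
      also have "\<dots> \<le> \<sigma> z"
        unfolding \<sigma>_def by (rule member_le_sum[OF c(1)]) (auto simp: C(2))
      finally show ?thesis by simp
    qed
    show "(max 0 (1 - 1 * \<sigma> z)) ^ 3 = 1" if z: "z \<notin> (\<Union>c\<in>C. cball c (2 * \<rho>))"
    proof -
      have "max 0 (2 - (1 / \<rho>\<^sup>2) * (norm (z - c))\<^sup>2) = 0" if "c \<in> C" for c
      proof -
        have "norm (z - c) > 2 * \<rho>" using z that by (auto simp: dist_norm norm_minus_commute)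
        then have "(2 * \<rho>)\<^sup>2 < (norm (z - c))\<^sup>2" using \<rho> by (intro power_strict_mono) auto
        then have "4 * \<rho>\<^sup>2 < (norm (z - c))\<^sup>2" by (simp add: power_mult_distrib)
        moreover have "\<rho>\<^sup>2 > 0" using \<rho> by simp
        ultimately have "2 * \<rho>\<^sup>2 < (norm (z - c))\<^sup>2" by linarith
        with \<open>\<rho>\<^sup>2 > 0\<close> have "2 < (1 / \<rho>\<^sup>2) * (norm (z - c))\<^sup>2" by (simp add: pos_less_divide_eq)
        then show ?thesis by simp
      qed
      then have "\<sigma> z = 0" unfolding \<sigma>_def by simp
      then show ?thesis by simp
    qed
  qed (use C(3) in auto)
qed

text \<open>A holomorphic function on \<open>G - K\<close> becomes differentiable everywhere after multiplication by a factor
  that vanishes near \<open>K\<close> and outside a compact part of \<open>G\<close>.\<close>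

lemma C1_deriv_zero_extension:
  assumes g: "C1_deriv A g g'" and AB: "open A" "open B" "A \<union> B = UNIV"
    and zero: "\<And>z. z \<in> B \<Longrightarrow> g z = 0"
  shows "C1_deriv UNIV g (\<lambda>z v. if z \<in> B then 0 else g' z v)"
proof -
  have dB: "(g has_derivative (\<lambda>v. 0)) (at z)" if "z \<in> B" for z
    by (rule has_derivative_transform_within_open[OF has_derivative_const[of 0] AB(2) that])
       (simp add: zero)
  have dA: "(g has_derivative g' z) (at z)" if "z \<in> A" for z
    using g that by (simp add: C1_deriv_def)
  have dAB: "g' z v = 0" if "z \<in> A" "z \<in> B" for z v
    using has_derivative_unique[OF dA dB, of z] that by metis
  show ?thesis unfolding C1_deriv_def
  proof (intro conjI ballI allI)
    fix z
    show "(g has_derivative (\<lambda>v. if z \<in> B then 0 else g' z v)) (at z)"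
      using dA[of z] dB[of z] AB(3) by (cases "z \<in> B") auto
  next
    fix v
    have "continuous_on A (\<lambda>z. if z \<in> B then 0 else g' z v)"
      using g by (auto simp: C1_deriv_def dAB intro: continuous_on_eq[of A "\<lambda>z. g' z v"])
    moreover have "continuous_on B (\<lambda>z. if z \<in> B then 0 else g' z v)"
      by (auto intro: continuous_on_eq[OF continuous_on_const[of B 0]])
    ultimately show "continuous_on UNIV (\<lambda>z. if z \<in> B then 0 else g' z v)"
      using continuous_on_open_Un[OF AB(1,2)] AB(3) by metis
  qed
qed

section \<open>The Hartogs extension theorem\<close>

lemma norm_axis: "norm (axis i x :: complex ^ 'n::finite) = cmod x"
proof -
  have "(\<Sum>j\<in>UNIV. (cmod (axis i x $ j))\<^sup>2) = (\<Sum>j\<in>UNIV. if j = i then (cmod x)\<^sup>2 else 0)"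
    by (rule sum.cong) (auto simp: axis_def)
  then show ?thesis by (simp add: norm_vec_def L2_set_def)
qed

text \<open>With \<open>\<phi> j = f \<cdot> dbar\<^sub>j \<omega>\<close>, extended by zero, the extension is
  \<open>F = \<omega> f + T/\<pi>\<close>, where \<open>T\<close> is the Cauchy transform of \<open>\<phi> i0\<close> along the axis \<open>i0\<close>. The
  compatibility \<open>dbar\<^sub>j (\<phi> i0) = dbar\<^sub>i\<^sub>0 (\<phi> j)\<close>, which holds because \<open>f\<close> is holomorphic
  and mixed derivatives of \<open>\<omega>\<close> commute, makes \<open>T/\<pi>\<close> cancel the defect \<open>\<phi> j\<close> of \<open>\<omega> f\<close> for every
  \<open>j\<close>, not only for \<open>j = i0\<close>. Where a second coordinate \<open>z\<^sub>j\<^sub>0\<close> has real part larger than anywhere on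
  the support of \<open>1 - \<omega>\<close>, the lines of integration miss that support and \<open>F = f\<close>.\<close>

theorem hartogs_extension:
  fixes G K :: "(complex ^ 'n::finite) set"
  assumes card: "CARD('n) \<ge> 2"
    and G: "open G" "bounded G" and K: "compact K" "K \<subseteq> G"
    and conn: "connected (G - K)" and f: "f \<in> hol_functions (G - K)"
  obtains F where "F \<in> hol_functions G" "\<And>z. z \<in> G - K \<Longrightarrow> F z = f z"
proof (cases "K = {}")
  case True
  with f that show ?thesis by auto
next
  case False
  obtain i0 j0 :: 'n where ij: "i0 \<noteq> j0"
    using card_le_Suc_iff card by (metis UNIV_I card_2_iff' ex_card numeral_2_eq_2 subset_UNIV)
  obtain \<omega> w N S where \<omega>: "C2_dbar \<omega> w" and N: "open N" "K \<subseteq> N" and S: "compact S" "S \<subseteq> G"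
    and \<omega>N: "\<And>z. z \<in> N \<Longrightarrow> \<omega> z = 0" and \<omega>S: "\<And>z. z \<notin> S \<Longrightarrow> \<omega> z = 1"
    using C2_dbar_cutoff[OF K(1) G(1) K(2)] by metis
  obtain \<omega>' w' where
    \<omega>1: "\<And>z. (\<omega> has_derivative \<omega>' z) (at z)" and \<omega>2: "\<And>v. continuous_on UNIV (\<lambda>z. \<omega>' z v)"
    and \<omega>3: "\<And>j z. dbar j (\<lambda>v. of_real (\<omega>' z v)) = w j z"
    and w1: "\<And>j. C1_deriv UNIV (w j) (w' j)"
    and w2: "\<And>i j z. dbar i (w' j z) = dbar j (w' i z)"
    using \<omega> unfolding C2_dbar_def by metis
  define A where "A = G - K"
  define B where "B = N \<union> - S"
  have oA: "open A" unfolding A_def using G(1) K(1) by (intro open_Diff compact_imp_closed)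
  have oB: "open B" unfolding B_def using N S by (intro open_Un open_Compl compact_imp_closed)
  have KS: "K \<subseteq> S" using N(2) \<omega>N \<omega>S by force
  have AB: "A \<union> B = UNIV" unfolding A_def B_def using N(2) S(2) by auto
  have wB: "w j z = 0" if "z \<in> B" for j z
  proof -
    have "(\<omega> has_derivative (\<lambda>v. 0)) (at z)"
    proof (cases "z \<in> N")
      case True
      show ?thesis
        by (rule has_derivative_transform_within_open[OF has_derivative_const[of 0] N(1) True])
           (simp add: \<omega>N)
    next
      case False
      then have z: "z \<in> - S" using that by (simp add: B_def)
      have oS: "open (- S)" using S(1) by (simp add: compact_imp_closed open_Compl)
      show ?thesis
        by (rule has_derivative_transform_within_open[OF has_derivative_const[of 1] oS z])
           (simp add: \<omega>S)
    qed
    then have "\<omega>' z = (\<lambda>v. 0)" using \<omega>1 has_derivative_unique by metis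
    then show ?thesis by (simp add: \<omega>3[symmetric] dbar_def)
  qed
  define f' where "f' z = frechet_derivative f (at z)" for z
  have f': "\<And>z. z \<in> A \<Longrightarrow> (f has_derivative f' z) (at z)" "\<And>v. continuous_on A (\<lambda>z. f' z v)"
    "\<And>z c v. z \<in> A \<Longrightarrow> f' z (c *s v) = c * f' z v"
    using hol_functions_frechet[OF f] hol_functions_continuous_derivative[OF _ f] oA
    by (auto simp: A_def f'_def)
  have dbarf: "dbar j (f' z) = 0" if "z \<in> A" for j z
  proof -
    have "axis j \<i> = \<i> *s (axis j 1 :: complex ^ 'n)" by (simp add: axis_def vec_eq_iff)
    then show ?thesis using f'(3)[OF that, of \<i> "axis j 1"] by (simp add: dbar_def)
  qed
  have cf: "continuous_on A f" using hol_functions_continuous_on[OF f] by (simp add: A_def)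
  define \<phi> where "\<phi> j z = w j z * f z" for j z
  define \<phi>' where "\<phi>' j z v = (if z \<in> B then 0 else w j z * f' z v + w' j z v * f z)" for j z v
  have \<phi>C1: "C1_deriv UNIV (\<phi> j) (\<phi>' j)" for j
  proof -
    have wd: "\<And>z. (w j has_derivative w' j z) (at z)" "\<And>v. continuous_on UNIV (\<lambda>z. w' j z v)"
      using w1[of j] by (auto simp: C1_deriv_def)
    have cw: "continuous_on UNIV (w j)"
      by (meson wd(1) continuous_at_imp_continuous_on has_derivative_continuous)
    have "C1_deriv A (\<phi> j) (\<lambda>z v. w j z * f' z v + w' j z v * f z)"
      unfolding C1_deriv_def \<phi>_def
      using continuous_on_subset[OF cw] continuous_on_subset[OF wd(2)]
      by (auto intro!: has_derivative_mult wd(1) f' continuous_intros cf)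
    from C1_deriv_zero_extension[OF this oA oB AB]
    show ?thesis unfolding \<phi>'_def[abs_def] by (simp add: \<phi>_def wB)
  qed
  have sym: "dbar i (\<phi>' j z) = dbar j (\<phi>' i z)" for i j z
  proof (cases "z \<in> B")
    case True
    then show ?thesis by (simp add: \<phi>'_def dbar_def)
  next
    case False
    then have zA: "z \<in> A" using AB by auto
    have "dbar i (\<phi>' j z) = w j z * dbar i (f' z) + dbar i (w' j z) * f z" for i j
      using False by (simp add: \<phi>'_def dbar_def field_simps)
    then show ?thesis using dbarf[OF zA] w2[of i j z] by simp
  qed
  obtain L where L: "\<And>z. z \<in> G \<Longrightarrow> norm z \<le> L" "L > 0" using G(2) bounded_pos by blast
  \<comment> \<open>A disc of this radius in the direction of \<open>i0\<close> around a point of \<open>G\<close> has its boundary outside \<open>G\<close>,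
    hence off the supports of the \<open>\<phi> j\<close>.\<close>
  define R where "R = 2 * L + 1"
  define T where "T z = cauchy_transform i0 R (\<phi> i0) z" for z
  define F where "F z = of_real (\<omega> z) * f z + (1 / pi) * T z" for z
  have \<phi>0: "\<phi> j z = 0" if "z \<notin> S" for j z
    using wB[of z j] that by (simp add: \<phi>_def B_def)
  have Fhol: "F \<in> hol_functions G"
    unfolding hol_functions_def
  proof (intro CollectI ballI)
    fix z assume z: "z \<in> G"
    define h' where "h' = (\<lambda>v. if z \<in> N then 0 else of_real (\<omega> z) * f' z v + of_real (\<omega>' z v) * f z)"
    have h': "((\<lambda>z. of_real (\<omega> z) * f z) has_derivative h') (at z)"
    proof (cases "z \<in> N")
      case True
      have "((\<lambda>z. of_real (\<omega> z) * f z) has_derivative (\<lambda>v. 0)) (at z)"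
        by (rule has_derivative_transform_within_open[OF has_derivative_const[of 0] N(1) True])
           (simp add: \<omega>N)
      then show ?thesis using True by (simp add: h'_def)
    next
      case False
      then have "z \<in> A" using z N(2) by (auto simp: A_def)
      then show ?thesis unfolding h'_def using False
        by (auto intro!: has_derivative_mult has_derivative_of_real \<omega>1 f')
    qed
    have dh: "dbar j h' = \<phi> j z" for j
    proof (cases "z \<in> N")
      case True
      then show ?thesis using wB[of z j] by (simp add: h'_def \<phi>_def B_def dbar_def)
    next
      case False
      then have zA: "z \<in> A" using z N(2) by (auto simp: A_def)
      have "dbar j h' = of_real (\<omega> z) * dbar j (f' z) + dbar j (\<lambda>v. of_real (\<omega>' z v)) * f z"
        using False by (simp add: h'_def dbar_def field_simps)
      then show ?thesis using dbarf[OF zA] by (simp add: \<omega>3 \<phi>_def)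
    qed
    define T' where "T' v = cauchy_transform i0 R (\<lambda>w. \<phi>' i0 w v) z" for v
    have T': "(T has_derivative T') (at z)"
      unfolding T_def[abs_def] T'_def[abs_def] by (rule cauchy_transform_has_derivative[OF \<phi>C1])
    have dT: "dbar j T' = - pi * \<phi> j z" for j
    proof -
      have "dbar j T' = cauchy_transform i0 R (\<lambda>w. dbar j (\<phi>' i0 w)) z"
        unfolding T'_def[abs_def] by (rule dbar_cauchy_transform[OF \<phi>C1])
      also have "\<dots> = cauchy_transform i0 R (\<lambda>w. dbar i0 (\<phi>' j w)) z"
        by (simp add: sym[of j i0])
      also have "\<dots> = - pi * \<phi> j z"
      proof (rule cauchy_transform_dbar[OF \<phi>C1])
        show "R \<ge> 0" using L by (simp add: R_def)
        fix t assume t: "cmod t = R"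
        have "norm (z + axis i0 t) \<ge> norm (axis i0 t :: complex ^ 'n) - norm z"
          by (metis add.commute norm_diff_ineq)
        then have "norm (z + axis i0 t) > L"
          using t L(1)[OF z] by (simp add: R_def norm_axis)
        then have "z + axis i0 t \<notin> S" using S(2) L(1) by force
        then show "\<phi> j (z + axis i0 t) = 0" by (rule \<phi>0)
      qed
      finally show ?thesis .
    qed
    define F' where "F' v = h' v + (1 / pi) * T' v" for v
    have F': "(F has_derivative F') (at z)"
      unfolding F_def[abs_def] F'_def[abs_def]
      by (intro has_derivative_add h' has_derivative_mult_right T')
    have "dbar j F' = dbar j h' + (1 / pi) * dbar j T'" for j
      by (simp add: F'_def dbar_def field_simps)
    then have "dbar j F' = 0" for j by (simp add: dh dT)
    then have "\<forall>c v. F' (c *s v) = c * F' v"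
      using linear_dbar_zero[OF has_derivative_linear[OF F']] by blast
    with F' show "\<exists>L. (F has_derivative L) (at z) \<and> (\<forall>c v. L (c *s v) = c * L v)" by blast
  qed
  have contRe: "continuous_on X (\<lambda>z::complex^'n. Re (z $ j0))" for X
    by (intro continuous_intros)
  obtain q where q: "q \<in> S" "\<And>y. y \<in> S \<Longrightarrow> Re (y $ j0) \<le> Re (q $ j0)"
    using continuous_attains_sup[OF S(1) _ contRe] False KS by blast
  \<comment> \<open>\<open>E\<close> is not empty: \<open>q\<close> maximizes the real part of the coordinate over \<open>S\<close> and is interior to \<open>G\<close>.\<close>
  define E where "E = G \<inter> {z. Re (z $ j0) > Re (q $ j0)}"
  have notS: "z \<notin> S" if "Re (z $ j0) > Re (q $ j0)" for z using q(2)[of z] that by auto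
  have FE: "F z = f z" if "z \<in> E" for z
  proof -
    have z: "Re (z $ j0) > Re (q $ j0)" using that by (simp add: E_def)
    have "z + axis i0 t \<notin> S" for t
      by (rule notS) (use z ij in \<open>simp add: axis_def\<close>)
    then have "T z = 0" unfolding T_def cauchy_transform_def split_beta by (simp add: \<phi>0)
    then show ?thesis by (simp add: F_def \<omega>S[OF notS[OF z]])
  qed
  have "open {z::complex^'n. Re (z $ j0) > Re (q $ j0)}"
    using open_Collect_less[OF continuous_on_const contRe[of UNIV]] by simp
  then have oE: "open E" unfolding E_def using G(1) by (rule open_Int[rotated])
  have EA: "E \<subseteq> G - K" unfolding E_def using notS KS by auto
  have neE: "E \<noteq> {}"
  proof -
    obtain e where e: "e > 0" "ball q e \<subseteq> G" using G(1) q(1) S(2) openE by blast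
    define z where "z = q + axis j0 (of_real (e / 2))"
    have "dist q z < e" using e by (simp add: z_def dist_norm norm_axis)
    moreover have "Re (z $ j0) > Re (q $ j0)" using e by (simp add: z_def axis_def)
    ultimately show ?thesis using e(2) by (auto simp: E_def)
  qed
  have "F z = f z" if "z \<in> G - K" for z
  proof -
    have "(\<lambda>z. F z - f z) \<in> hol_functions (G - K)"
      by (rule hol_functions_diff[OF hol_functions_mono[OF Fhol] f]) auto
    from hol_functions_identity[OF _ conn this oE neE EA _ that] oA FE
    show ?thesis by (simp add: A_def)
  qed
  with Fhol that show ?thesis by blast
qed

section \<open>Special unitary matrices with a prescribed column\<close>

definition herm :: "complex ^ 'n::finite \<Rightarrow> complex ^ 'n \<Rightarrow> complex" where
  "herm x y = (\<Sum>i\<in>UNIV. cnj (x $ i) * y $ i)"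

definition adj :: "complex ^ 'n::finite ^ 'n \<Rightarrow> complex ^ 'n ^ 'n" where
  "adj U = (\<chi> i j. cnj (U $ j $ i))"

lemma herm_self: "herm x x = of_real ((norm x)\<^sup>2)"
  by (simp add: herm_def norm_vec_def L2_set_def sum_nonneg complex_norm_square mult.commute
      del: of_real_power)

lemma herm_adj: "herm (adj U *v x) y = herm x (U *v y)"
proof -
  have "herm (adj U *v x) y = (\<Sum>i\<in>UNIV. \<Sum>j\<in>UNIV. U $ j $ i * cnj (x $ j) * y $ i)"
    by (simp add: herm_def adj_def matrix_vector_mult_def sum_distrib_right)
  also have "\<dots> = (\<Sum>j\<in>UNIV. \<Sum>i\<in>UNIV. U $ j $ i * cnj (x $ j) * y $ i)"
    by (rule sum.swap)
  also have "\<dots> = herm x (U *v y)"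
    by (simp add: herm_def matrix_vector_mult_def sum_distrib_left algebra_simps)
  finally show ?thesis .
qed

lemma SU_adj:
  assumes "U \<in> SU"
  shows "adj U *v (U *v x) = x" "U *v (adj U *v x) = x"
proof -
  have 1: "adj U ** U = mat 1" using assms by (simp add: SU_def adj_def)
  then have 2: "U ** adj U = mat 1" using matrix_left_right_inverse by blast
  show "adj U *v (U *v x) = x" "U *v (adj U *v x) = x"
    by (simp_all add: matrix_vector_mul_assoc 1 2)
qed

lemma SU_norm:
  assumes "U \<in> SU"
  shows "norm (U *v x) = norm x" "norm (adj U *v x) = norm x"
proof -
  have *: "norm (U *v x) = norm x" for x
  proof -
    have "herm (U *v x) (U *v x) = herm x x"
      by (metis herm_adj SU_adj[OF assms])
    then have "(norm (U *v x))\<^sup>2 = (norm x)\<^sup>2" by (simp add: herm_self del: of_real_power)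
    then show ?thesis by simp
  qed
  show "norm (U *v x) = norm x" by (rule *)
  show "norm (adj U *v x) = norm x" by (metis * SU_adj(2)[OF assms])
qed

lemma det_adj: "det (adj U) = cnj (det U)"
proof -
  have "adj U = transpose (\<chi> i j. cnj (U $ i $ j))"
    by (simp add: adj_def transpose_def)
  then have "det (adj U) = det (\<chi> i j. cnj (U $ i $ j))" by (metis det_transpose)
  also have "\<dots> = cnj (det U)" unfolding det_def by simp
  finally show ?thesis .
qed

text \<open>For a unit vector \<open>a\<close> other than \<open>e\<^sub>k\<close> put \<open>v = e\<^sub>k - a\<close>. The complex reflection \<open>1 - v v\<^sup>*/\<alpha>\<close> with
  \<open>\<alpha> = \<langle>v, e\<^sub>k\<rangle>\<close> maps \<open>e\<^sub>k\<close> to \<open>a\<close>, and it is unitary because \<open>\<langle>v, v\<rangle> = \<alpha> + cnj \<alpha>\<close>. A phase on another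
  basis vector, available in dimension at least two, then corrects the determinant.\<close>

lemma SU_prescribed_column:
  fixes a :: "complex ^ 'n::finite"
  assumes card: "CARD('n) \<ge> 2" and a: "norm a = 1"
  obtains U where "U \<in> SU" "U *v axis k 1 = a"
proof -
  have "\<exists>V. adj V ** V = mat 1 \<and> V *v axis k 1 = a"
  proof (cases "a = axis k 1")
    case True
    have "adj (mat 1) = (mat 1 :: complex ^ 'n ^ 'n)"
      by (simp add: adj_def mat_def vec_eq_iff)
    then show ?thesis using True by (intro exI[of _ "mat 1"]) simp
  next
    case False
    define v where "v = axis k 1 - a"
    define \<alpha> where "\<alpha> = cnj (v $ k)"
    have haa: "herm a a = 1" using a by (simp add: herm_self)
    have hvv: "herm v v = \<alpha> + cnj \<alpha>"
    proof -
      have "herm v v = (\<Sum>i\<in>UNIV. (if i = k then 1 - a $ k - cnj (a $ k) else 0) + cnj (a $ i) * a $ i)"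
        unfolding herm_def v_def by (intro sum.cong) (auto simp: axis_def algebra_simps)
      also have "\<dots> = (1 - a $ k - cnj (a $ k)) + herm a a"
        by (simp add: sum.distrib herm_def)
      finally show ?thesis by (simp add: haa \<alpha>_def v_def)
    qed
    have \<alpha>0: "\<alpha> \<noteq> 0"
      using hvv False by (auto simp: herm_self v_def)
    define V :: "complex ^ 'n ^ 'n" where "V = (\<chi> i j. (if i = j then 1 else 0) - v $ i * cnj (v $ j) / \<alpha>)"
    have "adj V ** V = mat 1"
    proof -
      have "(adj V ** V) $ i $ j = (mat 1 :: complex ^ 'n ^ 'n) $ i $ j" for i j
      proof -
        have "(adj V ** V) $ i $ j = (\<Sum>l\<in>UNIV. cnj (V $ l $ i) * V $ l $ j)"
          by (simp add: adj_def matrix_matrix_mult_def)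
        also have "\<dots> = (\<Sum>l\<in>UNIV. (if l = i then (if i = j then 1 else 0) - v $ i * cnj (v $ j) / \<alpha> else 0)
             + (if l = j then - (v $ i * cnj (v $ j) / cnj \<alpha>) else 0)
             + (cnj (v $ l) * v $ l) * (v $ i * cnj (v $ j) / (\<alpha> * cnj \<alpha>)))"
          by (intro sum.cong) (auto simp: V_def algebra_simps)
        also have "\<dots> = (if i = j then 1 else 0) - v $ i * cnj (v $ j) / \<alpha>
             - (v $ i * cnj (v $ j) / cnj \<alpha>) + herm v v * (v $ i * cnj (v $ j) / (\<alpha> * cnj \<alpha>))"
          by (simp add: sum.distrib herm_def sum_distrib_right sum_divide_distrib)
        also have "\<dots> = (if i = j then 1 else 0)"
          unfolding hvv using \<alpha>0 by (auto simp: field_simps)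
        finally show ?thesis by (simp add: mat_def)
      qed
      then show ?thesis by (simp add: vec_eq_iff)
    qed
    moreover have "V *v axis k 1 = a"
    proof -
      have "(V *v axis k 1) $ i = a $ i" for i
      proof -
        have "(V *v axis k 1) $ i = V $ i $ k"
          by (simp add: matrix_vector_mult_def axis_def if_distrib cong: if_cong)
        also have "\<dots> = a $ i" using \<alpha>0 by (auto simp: V_def \<alpha>_def v_def axis_def)
        finally show ?thesis .
      qed
      then show ?thesis by (simp add: vec_eq_iff)
    qed
    ultimately show ?thesis by blast
  qed
  then obtain V where V: "adj V ** V = mat 1" "V *v axis k 1 = a" by blast
  define c where "c = cnj (det V)"
  have cV: "det V * c = 1"
    using V(1) det_mul[of "adj V" V] by (simp add: det_adj c_def mult.commute)
  have cc: "cnj c * c = 1" using cV by (simp add: c_def)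
  obtain l where l: "l \<noteq> k"
  proof -
    have "UNIV \<noteq> {k}" using card by (metis card.empty card.insert empty_iff finite.emptyI
          numeral_le_one_iff One_nat_def semiring_norm(69))
    then show ?thesis using that by blast
  qed
  define D :: "complex ^ 'n ^ 'n" where "D = (\<chi> i j. if i = j then (if i = l then c else 1) else 0)"
  have detD: "det D = c"
  proof -
    have "det D = (\<Prod>i\<in>UNIV. D $ i $ i)" by (rule det_diagonal) (simp add: D_def)
    also have "\<dots> = c" by (simp add: D_def)
    finally show ?thesis .
  qed
  have adjD: "adj D ** D = mat 1"
  proof -
    have "(adj D ** D) $ i $ j = (mat 1 :: complex ^ 'n ^ 'n) $ i $ j" for i j
    proof -
      have "(adj D ** D) $ i $ j = (\<Sum>m\<in>UNIV. cnj (D $ m $ i) * D $ m $ j)"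
        by (simp add: adj_def matrix_matrix_mult_def)
      also have "\<dots> = (\<Sum>m\<in>UNIV. if m = i then (if i = j then 1 else 0) else 0)"
        using cc by (intro sum.cong) (auto simp: D_def)
      finally show ?thesis by (simp add: mat_def)
    qed
    then show ?thesis by (simp add: vec_eq_iff)
  qed
  have "adj (V ** D) = adj D ** adj V"
    by (simp add: adj_def matrix_matrix_mult_def vec_eq_iff mult.commute)
  then have "adj (V ** D) ** (V ** D) = mat 1"
    by (metis V(1) adjD matrix_mul_assoc matrix_mul_lid)
  moreover have "det (V ** D) = 1" by (simp add: det_mul detD cV)
  ultimately have SU: "V ** D \<in> SU" by (simp add: SU_def adj_def)
  have "D *v axis k 1 = axis k 1"
  proof -
    have "(D *v axis k 1) $ i = axis k 1 $ i" for i
    proof -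
      have "(D *v axis k 1) $ i = (\<Sum>m\<in>UNIV. if m = k then D $ i $ k else 0)"
        unfolding matrix_vector_mult_def axis_def vec_lambda_beta by (intro sum.cong) auto
      also have "\<dots> = axis k 1 $ i" using l by (simp add: D_def axis_def)
      finally show ?thesis .
    qed
    then show ?thesis by (simp add: vec_eq_iff)
  qed
  then have "(V ** D) *v axis k 1 = a" by (metis V(2) matrix_vector_mul_assoc)
  with SU that show ?thesis by blast
qed

section \<open>Levi-Hartogs figures across a sphere\<close>

lemma other_max_less_iff:
  fixes z :: "complex ^ 'n::finite"
  assumes "CARD('n) \<ge> 2"
  shows "other_max k z < e \<longleftrightarrow> (\<forall>i. i \<noteq> k \<longrightarrow> cmod (z $ i) < e)"
    and "e < other_max k z \<longleftrightarrow> (\<exists>i. i \<noteq> k \<and> e < cmod (z $ i))"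
proof -
  have "card (UNIV - {k}) \<noteq> 0" using assms by (simp add: card_Diff_singleton)
  then have ne: "UNIV - {k} \<noteq> {}" by force
  show "other_max k z < e \<longleftrightarrow> (\<forall>i. i \<noteq> k \<longrightarrow> cmod (z $ i) < e)"
    unfolding other_max_def using ne by (subst Max_less_iff) auto
  show "e < other_max k z \<longleftrightarrow> (\<exists>i. i \<noteq> k \<and> e < cmod (z $ i))"
    unfolding other_max_def using ne by (subst Max_gr_iff) auto
qed

lemma open_levi_hartogs_box:
  assumes "CARD('n::finite) \<ge> 2"
  shows "open (levi_hartogs_box (k :: 'n) \<epsilon>1 \<epsilon>2)"
proof -
  have "levi_hartogs_box k \<epsilon>1 \<epsilon>2 = (\<Inter>i\<in>UNIV - {k}. {z. cmod (z $ i) < \<epsilon>1}) \<inter>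
      {z. \<bar>Re (z $ k)\<bar> < \<epsilon>1} \<inter> {z. \<bar>Im (z $ k)\<bar> < \<epsilon>2}"
    by (auto simp: levi_hartogs_box_def other_max_less_iff(1)[OF assms])
  also have "open \<dots>"
    by (intro open_Int open_INT ballI open_Collect_less continuous_intros finite)
  finally show ?thesis .
qed

lemma levi_hartogs_box_norm:
  fixes k :: "'n::finite" and \<epsilon>1 \<epsilon>2 :: real
  assumes card: "CARD('n) \<ge> 2" and w: "w \<in> levi_hartogs_box k \<epsilon>1 \<epsilon>2" "0 < \<epsilon>2"
  shows "norm w < CARD('n) * \<epsilon>1 + \<epsilon>2"
proof -
  have wk: "cmod (w $ k) < \<epsilon>1 + \<epsilon>2" and wi: "i \<noteq> k \<Longrightarrow> cmod (w $ i) < \<epsilon>1" for i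
    using w cmod_le[of "w $ k"] by (auto simp: levi_hartogs_box_def other_max_less_iff(1)[OF card])
  have "norm w \<le> (\<Sum>i\<in>UNIV. cmod (w $ i))" by (simp add: norm_vec_def L2_set_le_sum)
  also have "\<dots> < (\<Sum>i\<in>UNIV. \<epsilon>1 + (if i = k then \<epsilon>2 else 0))"
    using wk wi by (intro sum_strict_mono) auto
  also have "\<dots> = CARD('n) * \<epsilon>1 + \<epsilon>2" by (simp add: sum.distrib)
  finally show ?thesis .
qed

lemma two_components_le_norm:
  fixes u :: "complex ^ 'n::finite"
  assumes "i \<noteq> k"
  shows "(cmod (u $ i))\<^sup>2 + (cmod (u $ k))\<^sup>2 \<le> (norm u)\<^sup>2"
proof -
  have "(\<Sum>j\<in>{i, k}. (cmod (u $ j))\<^sup>2) \<le> (\<Sum>j\<in>UNIV. (cmod (u $ j))\<^sup>2)"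
    by (rule sum_mono2) auto
  then show ?thesis using assms by (simp add: norm_vec_def L2_set_def sum_nonneg)
qed

text \<open>In model coordinates the centre of the sphere sits at \<open>\<i> r\<close> on the last axis, and the squared norm
  after the shift is \<open>x\<^sub>k\<^sup>2 + (r - y\<^sub>k)\<^sup>2\<close> plus the squares of the other coordinates. On the lower part of the
  figure \<open>y\<^sub>k < 0\<close> already gives a norm larger than \<open>r\<close>. On the annular part the gain of at least
  \<open>(\<epsilon>1 - \<epsilon>1\<^sup>2)\<^sup>2\<close> from another coordinate outweighs the loss of at most \<open>2 r \<epsilon>2\<close> from raising
  \<open>y\<^sub>k\<close>; this is the pseudoconcavity of the sphere, and it fixes how flat the figure has to be.\<close>

lemma levi_hartogs_outside_sphere:
  fixes k :: "'n::finite" and \<epsilon>1 \<epsilon>2 r :: real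
  assumes card: "CARD('n) \<ge> 2" and \<epsilon>: "0 < \<epsilon>1" "\<epsilon>1 < 1" "0 < \<epsilon>2" "\<epsilon>2 \<le> r"
    and small: "2 * r * \<epsilon>2 \<le> (\<epsilon>1 - \<epsilon>1\<^sup>2)\<^sup>2"
    and w: "w \<in> levi_hartogs k \<epsilon>1 \<epsilon>2"
  shows "norm (w + axis k (- \<i> * of_real r)) > r"
proof -
  define u where "u = w + axis k (- \<i> * of_real r)"
  have uk: "Im (u $ k) = Im (w $ k) - r" and ui: "i \<noteq> k \<Longrightarrow> u $ i = w $ i" for i
    by (auto simp: u_def axis_def)
  consider "Im (w $ k) < 0"
    | i where "i \<noteq> k" "\<epsilon>1 - \<epsilon>1\<^sup>2 < cmod (w $ i)" "\<bar>Im (w $ k)\<bar> < \<epsilon>2"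
    using w by (auto simp: levi_hartogs_def other_max_less_iff(2)[OF card])
  then have "norm u > r"
  proof cases
    case 1
    have "r < \<bar>Im (u $ k)\<bar>" using 1 uk \<epsilon> by simp
    also have "\<dots> \<le> cmod (u $ k)" by (rule abs_Im_le_cmod)
    also have "\<dots> \<le> norm u" by (rule Finite_Cartesian_Product.norm_nth_le)
    finally show ?thesis .
  next
    case 2
    have "\<epsilon>1\<^sup>2 < \<epsilon>1" using \<epsilon> by (simp add: power2_eq_square)
    then have "(\<epsilon>1 - \<epsilon>1\<^sup>2)\<^sup>2 < (cmod (u $ i))\<^sup>2" using 2 ui by (intro power_strict_mono) auto
    moreover have "(r - \<epsilon>2)\<^sup>2 \<le> (cmod (u $ k))\<^sup>2"
    proof (rule power_mono)
      have "r - \<epsilon>2 \<le> \<bar>Im (u $ k)\<bar>" using 2 uk by simp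
      also have "\<dots> \<le> cmod (u $ k)" by (rule abs_Im_le_cmod)
      finally show "r - \<epsilon>2 \<le> cmod (u $ k)" .
    qed (use \<epsilon> in simp)
    moreover have "r\<^sup>2 - 2 * r * \<epsilon>2 \<le> (r - \<epsilon>2)\<^sup>2" by (simp add: power2_diff)
    ultimately have "r\<^sup>2 < (norm u)\<^sup>2" using two_components_le_norm[OF 2(1), of u] small by linarith
    then show ?thesis by (rule power_less_imp_less_base) simp
  qed
  then show ?thesis by (simp add: u_def)
qed

lemma matrix_vector_mult_axis: "(U :: complex ^ 'n::finite ^ 'n) *v axis k c = c *s (U *v axis k 1)"
proof -
  have "axis k c = c *s (axis k 1 :: complex ^ 'n)" by (simp add: axis_def vec_eq_iff)
  then show ?thesis by (simp add: vector_scalar_commute)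
qed

text \<open>The figure is centred at the radial projection of \<open>q\<close> to the sphere of radius \<open>r\<close> and turned so that
  its upward direction \<open>\<i> e\<^sub>k\<close> points to the origin. In these coordinates \<open>q\<close> has height \<open>r - norm q\<close>.\<close>

lemma levi_hartogs_figure_across_sphere:
  fixes k :: "'n::finite" and q :: "complex ^ 'n" and \<epsilon>1 \<epsilon>2 r \<delta> :: real
  assumes card: "CARD('n) \<ge> 2" and \<epsilon>: "0 < \<epsilon>1" "\<epsilon>1 < 1" "0 < \<epsilon>2" "\<epsilon>2 \<le> r"
    and small: "2 * r * \<epsilon>2 \<le> (\<epsilon>1 - \<epsilon>1\<^sup>2)\<^sup>2"
    and \<delta>: "CARD('n) * \<epsilon>1 + 2 * \<epsilon>2 \<le> \<delta>"
    and q: "q \<noteq> 0" "norm q \<le> r" "r - \<epsilon>2 < norm q"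
  obtains H B where "(H, B) \<in> levi_hartogs_figures k" "open B" "q \<in> B" "B \<subseteq> ball q \<delta>"
    "H \<subseteq> B" "\<And>z. z \<in> H \<Longrightarrow> norm z > r"
proof -
  define a where "a = (\<i> / of_real (norm q)) *s q"
  have na: "norm a = 1"
  proof -
    have "(norm a)\<^sup>2 = (\<Sum>i\<in>UNIV. (cmod (q $ i))\<^sup>2 / (norm q)\<^sup>2)"
      by (simp add: a_def norm_vec_def[of "_ *s _"] L2_set_def sum_nonneg norm_mult norm_divide power_mult_distrib power_divide)
    also have "\<dots> = (norm q)\<^sup>2 / (norm q)\<^sup>2"
      by (simp add: sum_divide_distrib[symmetric] norm_vec_def L2_set_def sum_nonneg)
    finally show ?thesis using q(1) abs_square_eq_1[of "norm a"] by simp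
  qed
  obtain U where U: "U \<in> SU" "U *v axis k 1 = a" using SU_prescribed_column[OF card na] .
  define p where "p = U *v axis k (- \<i> * of_real r)"
  have qU: "q = U *v axis k (- \<i> * of_real (norm q))"
    unfolding matrix_vector_mult_axis[of U k "- \<i> * of_real (norm q)"] U(2) a_def
    using q(1) by (simp add: vec_eq_iff)
  have shift: "p + U *v w = U *v (w + axis k (- \<i> * of_real r))" for w
    by (simp add: p_def matrix_vector_right_distrib add.commute)
  define H where "H = (\<lambda>z. p + U *v z) ` levi_hartogs k \<epsilon>1 \<epsilon>2"
  define B where "B = (\<lambda>z. p + U *v z) ` levi_hartogs_box k \<epsilon>1 \<epsilon>2"
  show ?thesis
  proof (rule that[of H B])
    show "(H, B) \<in> levi_hartogs_figures k"
      unfolding levi_hartogs_figures_def H_def B_def using U(1) \<epsilon> by blast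
    have "B = {z. adj U *v (z - p) \<in> levi_hartogs_box k \<epsilon>1 \<epsilon>2}"
    proof (intro set_eqI iffI)
      fix z assume "z \<in> B"
      then show "z \<in> {z. adj U *v (z - p) \<in> levi_hartogs_box k \<epsilon>1 \<epsilon>2}"
        by (auto simp: B_def SU_adj[OF U(1)])
    next
      fix z assume "z \<in> {z. adj U *v (z - p) \<in> levi_hartogs_box k \<epsilon>1 \<epsilon>2}"
      moreover have "z = p + U *v (adj U *v (z - p))" by (simp add: SU_adj[OF U(1)])
      ultimately show "z \<in> B" unfolding B_def by blast
    qed
    moreover have "continuous_on UNIV (\<lambda>z. adj U *v (z - p))"
      unfolding matrix_vector_mult_def by (intro continuous_intros)
    ultimately show "open B"
      using open_vimage[OF open_levi_hartogs_box[OF card]] by (simp add: vimage_def)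
    define w where "w = axis k (\<i> * of_real (r - norm q))"
    have "w \<in> levi_hartogs_box k \<epsilon>1 \<epsilon>2"
      unfolding levi_hartogs_box_def other_max_less_iff(1)[OF card]
      using q \<epsilon> by (simp add: w_def axis_def)
    moreover have "p + U *v w = q"
    proof -
      have "w + axis k (- \<i> * of_real r) = axis k (- \<i> * of_real (norm q))"
        by (simp add: w_def axis_def vec_eq_iff algebra_simps)
      then show ?thesis unfolding shift using qU by simp
    qed
    ultimately show "q \<in> B" unfolding B_def by blast
    show "B \<subseteq> ball q \<delta>"
    proof
      fix z assume "z \<in> B"
      then obtain v where v: "v \<in> levi_hartogs_box k \<epsilon>1 \<epsilon>2" "z = p + U *v v" by (auto simp: B_def)
      have "z - q = U *v (v - w)" using v(2) \<open>p + U *v w = q\<close>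
        by (auto simp: matrix_vector_mult_diff_distrib)
      then have "norm (z - q) = norm (v - w)" by (simp add: SU_norm[OF U(1)])
      also have "\<dots> \<le> norm v + norm w" by (rule norm_triangle_ineq4)
      also have "norm w = r - norm q"
      proof -
        have "(\<Sum>j\<in>UNIV. (cmod (w $ j))\<^sup>2) = (\<Sum>j\<in>UNIV. if j = k then (r - norm q)\<^sup>2 else 0)"
          unfolding w_def axis_def by (intro sum.cong) (auto simp: norm_mult simp del: of_real_diff)
        then show ?thesis using q by (simp add: norm_vec_def L2_set_def)
      qed
      finally have "norm (z - q) < CARD('n) * \<epsilon>1 + 2 * \<epsilon>2"
        using levi_hartogs_box_norm[OF card v(1) \<epsilon>(3)] q by linarith
      then show "z \<in> ball q \<delta>" using \<delta> by (simp add: dist_norm norm_minus_commute)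
    qed
    have "levi_hartogs k \<epsilon>1 \<epsilon>2 \<subseteq> levi_hartogs_box k \<epsilon>1 \<epsilon>2"
      using \<epsilon> by (auto simp: levi_hartogs_def levi_hartogs_box_def)
    then show "H \<subseteq> B" unfolding H_def B_def by blast
    fix z assume "z \<in> H"
    then obtain v where v: "v \<in> levi_hartogs k \<epsilon>1 \<epsilon>2" "z = p + U *v v" by (auto simp: H_def)
    then show "norm z > r"
      using levi_hartogs_outside_sphere[OF card \<epsilon> small v(1)] by (simp add: shift SU_norm[OF U(1)])
  qed
qed

lemma obtained_by_pushing_mono:
  assumes "obtained_by_pushing \<H> V f W g" "\<H> \<subseteq> \<H>'"
  shows "obtained_by_pushing \<H>' V f W g"
  using assms by (induction rule: obtained_by_pushing.induct)
    (auto intro: obtained_by_pushing.intros)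

text \<open>Once a global function \<open>F\<close> is known, its restriction to a box is the local extension there, so pushing into
  several boxes only has to respect the inclusion of the figures in \<open>W\<close>.\<close>

lemma push_into_boxes:
  assumes W: "obtained_by_pushing \<H> V f W F" and F: "F \<in> hol_functions G"
    and X: "finite X" "X \<subseteq> \<H>" "\<And>H B. (H, B) \<in> X \<Longrightarrow> H \<subseteq> W \<and> B \<subseteq> G"
  shows "obtained_by_pushing \<H> V f (W \<union> \<Union>(snd ` X)) F"
  using X
proof (induction X rule: finite_induct)
  case empty
  then show ?case using W by simp
next
  case (insert HB X)
  obtain H B where HB: "HB = (H, B)" by force
  have HBW: "H \<subseteq> W" "B \<subseteq> G" using insert.prems(2)[of H B] HB by auto
  then have "F \<in> hol_functions B" using F by (auto simp: hol_functions_def)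
  then have "obtained_by_pushing \<H> V f B F"
    using insert.prems(1) HB HBW by (intro obtained_by_pushing.push[OF W, of H B]) auto
  moreover have "obtained_by_pushing \<H> V f (W \<union> \<Union>(snd ` X)) F"
    using insert.IH insert.prems by auto
  ultimately have "obtained_by_pushing \<H> V f (B \<union> (W \<union> \<Union>(snd ` X))) F"
    by (rule obtained_by_pushing.glue) auto
  then show ?case by (simp add: HB Un_ac)
qed

text \<open>Descent along spheres. The sizes \<open>\<epsilon>1\<close> and \<open>\<epsilon>2\<close> depend only on \<open>\<delta>\<close>, \<open>c\<close>, the dimension and a
  bound \<open>L\<close> for \<open>G\<close>, so every round lowers the radius by the same \<open>\<epsilon>2 / 2\<close>; half of \<open>\<epsilon>2\<close> keeps the points of the
  closed shell within reach of the open boxes. The figures are chosen before \<open>F\<close>, so the same finite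
  family serves all functions.\<close>

lemma filling_by_pushing:
  fixes V G :: "(complex ^ 'n::finite) set" and k :: 'n
  assumes card: "CARD('n) \<ge> 2"
    and G: "open G" "bounded G" and V: "open V" "V \<subseteq> G" "compact (G - V)"
    and \<delta>: "\<delta> > 0" "\<And>q. q \<in> G - V \<Longrightarrow> ball q \<delta> \<subseteq> G"
    and c: "c > 0" "\<And>q. q \<in> G - V \<Longrightarrow> c \<le> norm q"
  obtains \<H> where "finite \<H>" "\<H> \<subseteq> levi_hartogs_figures k"
    "\<And>F f. F \<in> hol_functions G \<Longrightarrow> \<forall>z\<in>V. F z = f z \<Longrightarrow> obtained_by_pushing \<H> V f G F"
proof -
  obtain L where L: "L > 0" "\<And>z. z \<in> G \<Longrightarrow> norm z \<le> L" using G(2) bounded_pos by blast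
  define \<epsilon>1 where "\<epsilon>1 = min (1/2) (\<delta> / (2 * CARD('n)))"
  have n: "CARD('n) > 0" using card by simp
  have \<epsilon>1: "0 < \<epsilon>1" "\<epsilon>1 < 1" using \<delta> n by (auto simp: \<epsilon>1_def)
  have "\<epsilon>1 \<le> \<delta> / (2 * CARD('n))" by (simp add: \<epsilon>1_def)
  then have n\<epsilon>1: "CARD('n) * \<epsilon>1 \<le> \<delta> / 2" using n by (simp add: field_simps)
  have pos: "\<epsilon>1 - \<epsilon>1\<^sup>2 > 0" using \<epsilon>1 by (simp add: power2_eq_square)
  define \<epsilon>2 where "\<epsilon>2 = min (min (\<delta> / 4) c) ((\<epsilon>1 - \<epsilon>1\<^sup>2)\<^sup>2 / (2 * L))"
  have \<epsilon>2: "0 < \<epsilon>2" "\<epsilon>2 \<le> c" "\<epsilon>2 \<le> \<delta> / 4"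
    using \<delta> c L pos by (auto simp: \<epsilon>2_def)
  have "\<epsilon>2 \<le> (\<epsilon>1 - \<epsilon>1\<^sup>2)\<^sup>2 / (2 * L)" by (simp add: \<epsilon>2_def)
  then have small: "2 * L * \<epsilon>2 \<le> (\<epsilon>1 - \<epsilon>1\<^sup>2)\<^sup>2" using L by (simp add: field_simps)
  define W where "W r = V \<union> (G \<inter> {z. norm z > r})" for r
  define reach where "reach \<H> r \<longleftrightarrow> (\<forall>F f. F \<in> hol_functions G \<longrightarrow> (\<forall>z\<in>V. F z = f z)
      \<longrightarrow> obtained_by_pushing \<H> V f (W r) F)" for \<H> r
  have oW: "open (W r)" for r
  proof -
    have "open {z :: complex ^ 'n. norm z > r}" by (intro open_Collect_less continuous_intros)
    then show ?thesis unfolding W_def using G(1) V(1) by blast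
  qed
  \<comment> \<open>One round: cover the compact shell between the radii \<open>r - \<epsilon>2 / 2\<close> and \<open>r\<close>.\<close>
  have step: "\<exists>\<H>'. finite \<H>' \<and> \<H>' \<subseteq> levi_hartogs_figures k \<and> reach \<H>' (r - \<epsilon>2 / 2)"
    if \<H>: "finite \<H>" "\<H> \<subseteq> levi_hartogs_figures k" "reach \<H> r" and r: "r \<le> L" for \<H> r
  proof -
    define C where "C = (G - V) \<inter> {z. r - \<epsilon>2 / 2 \<le> norm z \<and> norm z \<le> r}"
    have "closed {z :: complex ^ 'n. r - \<epsilon>2 / 2 \<le> norm z \<and> norm z \<le> r}"
      by (intro closed_Collect_conj closed_Collect_le continuous_intros)
    then have C: "compact C" unfolding C_def using V(3) by (rule compact_Int_closed[rotated])
    have "\<exists>H B. (H, B) \<in> levi_hartogs_figures k \<and> open B \<and> q \<in> B \<and> B \<subseteq> ball q \<delta> \<and>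
        H \<subseteq> B \<and> (\<forall>z\<in>H. norm z > r)" if q: "q \<in> C" for q
    proof -
      have q': "q \<in> G - V" "r - \<epsilon>2 / 2 \<le> norm q" "norm q \<le> r" using q by (auto simp: C_def)
      have "c \<le> norm q" using c q' by blast
      then have "q \<noteq> 0" "\<epsilon>2 \<le> r" using c(1) \<epsilon>2 q'(3) by auto
      moreover have "2 * r * \<epsilon>2 \<le> (\<epsilon>1 - \<epsilon>1\<^sup>2)\<^sup>2"
        using r \<epsilon>2 by (intro order_trans[OF _ small]) simp
      moreover have "CARD('n) * \<epsilon>1 + 2 * \<epsilon>2 \<le> \<delta>" using n\<epsilon>1 \<epsilon>2 by linarith
      moreover have "r - \<epsilon>2 < norm q" using q' \<epsilon>2 by linarith
      ultimately show ?thesis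
        using levi_hartogs_figure_across_sphere[OF card \<epsilon>1 \<epsilon>2(1), of r \<delta> q k] q'(3) by metis
    qed
    then obtain H B where HB: "\<And>q. q \<in> C \<Longrightarrow> (H q, B q) \<in> levi_hartogs_figures k \<and> open (B q) \<and>
        q \<in> B q \<and> B q \<subseteq> ball q \<delta> \<and> H q \<subseteq> B q \<and> (\<forall>z\<in>H q. norm z > r)" by metis
    obtain Q where Q: "Q \<subseteq> C" "finite Q" "C \<subseteq> (\<Union>q\<in>Q. B q)"
      using compactE_image[OF C, of C B] HB by blast
    define X where "X = (\<lambda>q. (H q, B q)) ` Q"
    have BG: "B q \<subseteq> G" if "q \<in> Q" for q
      using HB[of q] \<delta>(2)[of q] Q(1) that by (fastforce simp: C_def)
    have "obtained_by_pushing (\<H> \<union> X) V f (W (r - \<epsilon>2 / 2)) F"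
      if F: "F \<in> hol_functions G" "\<forall>z\<in>V. F z = f z" for F f
    proof -
      have "obtained_by_pushing (\<H> \<union> X) V f (W r) F"
        using \<H>(3) F unfolding reach_def by (meson obtained_by_pushing_mono sup_ge1)
      then have "obtained_by_pushing (\<H> \<union> X) V f (W r \<union> \<Union>(snd ` X)) F"
      proof (rule push_into_boxes[OF _ F(1)])
        fix H' B' assume "(H', B') \<in> X"
        then obtain q where q: "q \<in> Q" "H' = H q" "B' = B q" by (auto simp: X_def)
        then show "H' \<subseteq> W r \<and> B' \<subseteq> G" using BG[of q] HB[of q] Q(1) by (auto simp: W_def)
      qed (auto simp: X_def Q(2))
      then show ?thesis
      proof (rule obtained_by_pushing.restrict)
        show "W (r - \<epsilon>2 / 2) \<subseteq> W r \<union> \<Union>(snd ` X)"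
          using Q(3) by (force simp: W_def X_def C_def)
      qed (auto simp: oW)
    qed
    then have "reach (\<H> \<union> X) (r - \<epsilon>2 / 2)" by (simp add: reach_def)
    moreover have "X \<subseteq> levi_hartogs_figures k" using HB Q(1) by (auto simp: X_def)
    ultimately show ?thesis using \<H> Q(2) by (intro exI[of _ "\<H> \<union> X"]) (auto simp: X_def)
  qed
  have all: "\<exists>\<H>. finite \<H> \<and> \<H> \<subseteq> levi_hartogs_figures k \<and> reach \<H> (L - m * (\<epsilon>2 / 2))" for m :: nat
  proof (induction m)
    case 0
    have WV: "W L = V" using L by (force simp: W_def)
    have "obtained_by_pushing {} V f (W L) F" if "\<forall>z\<in>V. F z = f z" for F f
      unfolding WV by (rule obtained_by_pushing.restrict[OF obtained_by_pushing.start V(1)]) (use that in auto)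
    then show ?case by (intro exI[of _ "{}"]) (simp add: reach_def)
  next
    case (Suc m)
    then obtain \<H> where "finite \<H>" "\<H> \<subseteq> levi_hartogs_figures k" "reach \<H> (L - m * (\<epsilon>2 / 2))" by blast
    moreover have "L - m * (\<epsilon>2 / 2) \<le> L" using \<epsilon>2 by simp
    moreover have "L - Suc m * (\<epsilon>2 / 2) = L - m * (\<epsilon>2 / 2) - \<epsilon>2 / 2" by (simp add: field_simps)
    ultimately show ?case using step[of \<H> "L - m * (\<epsilon>2 / 2)"] by presburger
  qed
  obtain m :: nat where m: "L / (\<epsilon>2 / 2) < m" using reals_Archimedean2 by blast
  then have "L < m * (\<epsilon>2 / 2)" using \<epsilon>2 by (simp add: field_simps)
  then have "W (L - m * (\<epsilon>2 / 2)) = G"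
    using V(2) c by (force simp: W_def)
  with all[of m] that show ?thesis unfolding reach_def by metis
qed

section \<open>Extension from the tube around a hypersurface\<close>

lemma connected_tube:
  fixes M :: "'a::real_normed_vector set"
  assumes "connected M"
  shows "connected (tube \<delta> M)"
proof -
  have "tube \<delta> M = (\<lambda>(x, y). x + y) ` (M \<times> ball 0 \<delta>)"
  proof (intro set_eqI iffI)
    fix z assume "z \<in> tube \<delta> M"
    then obtain x where "x \<in> M" "z \<in> ball x \<delta>" by (auto simp: tube_def)
    then show "z \<in> (\<lambda>(x, y). x + y) ` (M \<times> ball 0 \<delta>)"
      by (intro image_eqI[of _ _ "(x, z - x)"]) (auto simp: dist_norm norm_minus_commute)
  next
    fix z assume "z \<in> (\<lambda>(x, y). x + y) ` (M \<times> ball 0 \<delta>)"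
    then obtain x y where "x \<in> M" "norm y < \<delta>" "z = x + y" by auto
    then show "z \<in> tube \<delta> M" by (auto simp: tube_def dist_norm intro!: bexI[of _ x])
  qed
  moreover have "connected (M \<times> ball (0 :: 'a) \<delta>)"
    using assms by (simp add: connected_Times_eq)
  moreover have "continuous_on (M \<times> ball (0 :: 'a) \<delta>) (\<lambda>(x, y). x + y)"
    unfolding split_beta by (intro continuous_intros)
  ultimately show ?thesis by (simp add: connected_continuous_image)
qed

theorem theorem2p7:
  fixes M \<Omega> :: "(complex ^ 'n::finite) set"
    and k :: 'n
    and \<kappa> :: nat
    and p :: "nat \<Rightarrow> complex ^ 'n"
  assumes "CARD('n) \<ge> 2"
    and "bounded M" and "connected M" and "smooth_hypersurface M"
    and "open \<Omega>" and "connected \<Omega>" and "\<Omega> \<noteq> {}" and "bounded \<Omega>"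
    and "frontier \<Omega> = M"
    and "2 \<le> infdist 0 (closure \<Omega>)" and "infdist 0 (closure \<Omega>) \<le> 5"
    and "morse_on M norm"
    and "critical_points M norm = p ` {1..\<kappa>}"
    and "strict_mono_on {1..\<kappa>} (\<lambda>l. norm (p l))"
    and "\<forall>l\<in>{1..\<kappa>}. 2 \<le> norm (p l) \<and> norm (p l) \<le> 5 + diameter (closure \<Omega>)"
  shows "\<exists>\<delta>1>0. \<forall>\<delta>. 0 < \<delta> \<and> \<delta> \<le> \<delta>1 \<longrightarrow>
           hol_extends (tube \<delta> M) \<Omega> \<and> extends_by_pushing k (tube \<delta> M) \<Omega>"
  \<comment> \<open>The argument works for every radius, so the bound \<open>1\<close> is arbitrary.\<close>
proof (intro exI[of _ 1] conjI allI impI)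
  fix \<delta> :: real assume \<delta>: "0 < \<delta> \<and> \<delta> \<le> 1"
  define V where "V = tube \<delta> M"
  define G where "G = V \<union> \<Omega>"
  have oV: "open V" unfolding V_def tube_def by blast
  have MV: "M \<subseteq> V" using \<delta> by (force simp: V_def tube_def)
  have oG: "open G" unfolding G_def using oV \<open>open \<Omega>\<close> by blast
  have bG: "bounded G"
  proof -
    obtain b where b: "\<And>x. x \<in> M \<Longrightarrow> norm x \<le> b" using \<open>bounded M\<close> by (auto simp: bounded_iff)
    have "norm z \<le> b + \<delta>" if "z \<in> V" for z
    proof -
      obtain x where x: "x \<in> M" "norm (z - x) < \<delta>"
        using \<open>z \<in> V\<close> by (auto simp: V_def tube_def dist_norm norm_minus_commute)
      then show ?thesis using b[OF x(1)] norm_triangle_sub[of z x] by linarith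
    qed
    then have "bounded V" by (auto simp: bounded_iff)
    then show ?thesis unfolding G_def using \<open>bounded \<Omega>\<close> by simp
  qed
  have K: "G - V = closure \<Omega> - V"
    using MV \<open>frontier \<Omega> = M\<close> \<open>open \<Omega>\<close> closure_subset[of \<Omega>]
    by (auto simp: G_def frontier_def interior_open)
  have cK: "compact (G - V)"
    unfolding K using \<open>bounded \<Omega>\<close> oV by (intro compact_diff) simp
  have GKV: "G - (G - V) = V" by (auto simp: G_def)
  have balls: "ball q \<delta> \<subseteq> G" if q: "q \<in> G - V" for q
  proof -
    have "ball q \<delta> \<inter> frontier \<Omega> = {}"
      using q \<open>frontier \<Omega> = M\<close> by (auto simp: V_def tube_def dist_commute)
    moreover have "ball q \<delta> \<inter> \<Omega> \<noteq> {}" 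
    proof -
      have "q \<in> ball q \<delta>" using \<delta> by simp
      then show ?thesis using q unfolding G_def by blast
    qed
    ultimately have "ball q \<delta> - \<Omega> = {}" using connected_Int_frontier[OF connected_ball] by metis
    then show ?thesis by (auto simp: G_def)
  qed
  have far: "2 \<le> norm q" if "q \<in> G - V" for q
  proof -
    have "q \<in> closure \<Omega>" using that K by auto
    then have "infdist 0 (closure \<Omega>) \<le> dist 0 q" by (rule infdist_le)
    then show ?thesis using \<open>2 \<le> infdist 0 (closure \<Omega>)\<close> by simp
  qed
  obtain \<H> where \<H>: "finite \<H>" "\<H> \<subseteq> levi_hartogs_figures k"
    "\<And>F f. F \<in> hol_functions G \<Longrightarrow> \<forall>z\<in>V. F z = f z \<Longrightarrow> obtained_by_pushing \<H> V f G F"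
  proof (rule filling_by_pushing[of G V \<delta> 2 k])
    show "V \<subseteq> G" by (simp add: G_def)
  qed (use assms(1) oG bG oV cK balls far \<delta> in auto)
  have extension: "\<exists>F\<in>hol_functions G. \<forall>z\<in>V. F z = f z" if f: "f \<in> hol_functions V" for f
    using hartogs_extension[OF assms(1) oG bG cK, of f] f connected_tube[OF \<open>connected M\<close>, of \<delta>]
    unfolding GKV V_def[symmetric] by (metis Diff_subset)
  show "hol_extends (tube \<delta> M) \<Omega>"
    unfolding hol_extends_def V_def[symmetric] G_def[symmetric] using extension by blast
  show "extends_by_pushing k (tube \<delta> M) \<Omega>"
    unfolding extends_by_pushing_def V_def[symmetric] G_def[symmetric]
  proof (intro exI[of _ \<H>] conjI ballI)
    fix f assume "f \<in> hol_functions V"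
    then obtain F where "F \<in> hol_functions G" "\<forall>z\<in>V. F z = f z" using extension by blast
    with \<H>(3) show "\<exists>F\<in>hol_functions G. (\<forall>z\<in>V. F z = f z) \<and> obtained_by_pushing \<H> V f G F"
      by blast
  qed (use \<H> in auto)
qed simp

end
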